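(* Let $\mu,\nu\in\mathcal{P}(\mathcal{X})$, $\varepsilon>0$, and $c:\mathcal{X}\times\mathcal{X}\to\mathbb{R}_+$ measurable with $\int c\,d\mu\otimes\nu<\infty$. Assume there exist $p>0$ and $\delta>0$ such that \[ \lim_{r\to\infty}\frac{\sup_{x,y\in B_r}c(x,y)}{r^p}=0\quad\text{and}\quad\lim_{r\to\infty}\frac{\max\{\mu(\mathcal{X}\setminus B_r),\nu(\mathcal{X}\setminus B_r)\}}{\exp(-r^{p+\delta})}=0 . \] Let $g_1^*,g_2^*$, $\pi^*$, and the Sinkhorn iterates $g_1^{(n)},g_2^{(n)},\pi^{(n)}$ be as in the context. Then there exist parameters $0<m_1\le m_2$ and tail functions $\alpha_1,\tilde\alpha_1$ defining a cone $\mathcal{G}^{\mu}_{\alpha_1,\tilde\alpha_1}$, parameters $0<m_1'\le m_2'$ and tail functions $\alpha_2,\tilde\alpha_2$ defining a cone $\mathcal{G}^{\nu}_{\alpha_2,\tilde\alpha_2}$, and numbers $A>0$, $\kappa\in(0,1)$ such that for all $n\in\mathbb{N}$, \[ d_{\mathcal{G}^{\mu}_{\alpha_1,\tilde\alpha_1}}\big(g_1^*,g_1^{(n)}\big)+d_{\mathcal{G}^{\nu}_{\alpha_2,\tilde\alpha_2}}\big(g_2^*,g_2^{(n)}\big)\le A\kappa^n \quad\text{and}\quad \|\pi^{(n)}-\pi^*\|_{TV}\le A\kappa^n . \]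
   Context: $\mathcal{X}$ is a Polish space with metric $d_{\mathcal{X}}$, $x_0\in\mathcal{X}$ fixed, $B_r=\{x: d_{\mathcal{X}}(x_0,x)\le r\}$, $B_r^{\mathsf c}=\mathcal{X}\setminus B_r$. Entropic optimal transport: minimize $\int c\,d\pi+\varepsilon H(\pi,\mu\otimes\nu)$ over couplings $\pi$ of $\mu,\nu$ ($H$ relative entropy). Its unique optimizer $\pi^*$ has density $\frac{d\pi^*}{d\mu\otimes\nu}(x,y)=e^{-c(x,y)/\varepsilon}g_1^*(x)g_2^*(y)$, where $g_1^*,g_2^*>0$ are measurable solutions of the Schrödinger equations $g_1^*=T_\nu(g_2^* )$, $g_2^*=T_\mu(g_1^* )$, with $T_\nu(g)(x)=\big(\int e^{-c(x,y)/\varepsilon}g(y)\,\nu(dy)\big)^{-1}$ and $T_\mu(g)(y)=\big(\int e^{-c(x,y)/\varepsilon}g(x)\,\mu(dx)\big)^{-1}$. Sinkhorn's algorithm: $g_1^{(0)}=g_2^{(0)}\equiv1$, $g_1^{(n+1)}=T_\nu(g_2^{(n)})$, $g_2^{(n+1)}=T_\mu(g_1^{(n+1)})$, and $\frac{d\pi^{(n)}}{d\mu\otimes\nu}(x,y)=e^{-c(x,y)/\varepsilon}g_1^{(n)}(x)g_2^{(n)}(y)$. $\|\cdot\|_{TV}$ is the total variation norm (here $\|\pi^{(n)}-\pi^*\|_{TV}$ is the $L^1(\mu\otimes\nu)$-distance of the densities). A tail function is a non-increasing $\alpha:(0,\infty)\to[0,\infty)$ with $\lim_{r\to\infty}\alpha(r)=0$.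 For $\rho\in\mathcal{P}(\mathcal{X})$, $0<m_1\le m_2$ and tail functions $\alpha,\tilde\alpha$ (standing assumptions $\rho(B_{m_1})>0$, $\alpha>0$): $\mathcal{F}^{\rho}_{\alpha,\tilde\alpha}$ is the set of $f\in L^2(\rho)$ with $f\mathbf 1_{B_{m_2}}\ge0$ $\rho$-a.s., $\int_{B_r^{\mathsf c}}f_+d\rho\le\alpha(r)\int fd\rho$ for $r\ge m_1$, $\int_{B_r^{\mathsf c}}f_-d\rho\le\tilde\alpha(r)\int fd\rho$ for $r\ge m_2$; $\mathcal{G}^{\rho}_{\alpha,\tilde\alpha}=\{g\in L^2(\rho):\int fg\,d\rho\ge0\ \forall f\in\mathcal{F}^{\rho}_{\alpha,\tilde\alpha}\}$. Hilbert's metric for a cone $C$: $f\le_C g$ iff $g-f\in C$; $f\sim_C g$ iff each dominates the other ($f\le_C bg$ for some $b>0$, and vice versa); $M(f,g)=\inf\{b>0:bg-f\in C\}$, $m(f,g)=\sup\{a>0:f-ag\in C\}$; $d_C(f,g)=\log(M/m)$ if $f\sim_C g$, $g\ne0$, and $\infty$ otherwise. *)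

theory Defs
  imports "HOL-Probability.Probability"
begin

definition L2 :: "'a measure \<Rightarrow> ('a \<Rightarrow> real) set" where
  "L2 \<rho> = {f. f \<in> borel_measurable \<rho> \<and> integrable \<rho> (\<lambda>x. (f x)\<^sup>2)}"

definition tail_function :: "(real \<Rightarrow> real) \<Rightarrow> bool" where
  "tail_function \<alpha> \<longleftrightarrow>
     (\<forall>r s. 0 < r \<longrightarrow> r \<le> s \<longrightarrow> \<alpha> s \<le> \<alpha> r) \<and>
     (\<forall>r > 0. 0 \<le> \<alpha> r) \<and> (\<alpha> \<longlongrightarrow> 0) at_top"

definition coneF ::
  "'a::metric_space \<Rightarrow> 'a measure \<Rightarrow> real \<Rightarrow> real \<Rightarrow> (real \<Rightarrow> real) \<Rightarrow> (real \<Rightarrow> real)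
     \<Rightarrow> ('a \<Rightarrow> real) set" where
  "coneF x0 \<rho> m1 m2 \<alpha> \<alpha>' =
    {f \<in> L2 \<rho>.
       (AE x in \<rho>. x \<in> cball x0 m2 \<longrightarrow> 0 \<le> f x) \<and>
       (\<forall>r \<ge> m1. set_lebesgue_integral \<rho> (- cball x0 r) (\<lambda>x. max (f x) 0)
                    \<le> \<alpha> r * integral\<^sup>L \<rho> f) \<and>
       (\<forall>r \<ge> m2. set_lebesgue_integral \<rho> (- cball x0 r) (\<lambda>x. max (- f x) 0)
                    \<le> \<alpha>' r * integral\<^sup>L \<rho> f)}"

definition coneG ::
  "'a::metric_space \<Rightarrow> 'a measure \<Rightarrow> real \<Rightarrow> real \<Rightarrow> (real \<Rightarrow> real) \<Rightarrow> (real \<Rightarrow> real)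
     \<Rightarrow> ('a \<Rightarrow> real) set" where
  "coneG x0 \<rho> m1 m2 \<alpha> \<alpha>' =
    {g \<in> L2 \<rho>. \<forall>f \<in> coneF x0 \<rho> m1 m2 \<alpha> \<alpha>'. 0 \<le> (\<integral>x. f x * g x \<partial>\<rho>)}"

text \<open>Hilbert's projective metric for a cone C of functions on (the L2 space of) rho.
  f <=_C g iff g - f in C.  The zero element is the rho-a.e. zero function.\<close>
definition cone_le :: "('a \<Rightarrow> real) set \<Rightarrow> ('a \<Rightarrow> real) \<Rightarrow> ('a \<Rightarrow> real) \<Rightarrow> bool" where
  "cone_le C f g \<longleftrightarrow> (\<lambda>x. g x - f x) \<in> C"

definition cone_comparable :: "('a \<Rightarrow> real) set \<Rightarrow> ('a \<Rightarrow> real) \<Rightarrow> ('a \<Rightarrow> real) \<Rightarrow> bool" where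
  "cone_comparable C f g \<longleftrightarrow>
     (\<exists>b > 0. cone_le C f (\<lambda>x. b * g x)) \<and> (\<exists>b > 0. cone_le C g (\<lambda>x. b * f x))"

definition hilbert_M :: "('a \<Rightarrow> real) set \<Rightarrow> ('a \<Rightarrow> real) \<Rightarrow> ('a \<Rightarrow> real) \<Rightarrow> real" where
  "hilbert_M C f g = Inf {b. b > 0 \<and> (\<lambda>x. b * g x - f x) \<in> C}"

definition hilbert_m :: "('a \<Rightarrow> real) set \<Rightarrow> ('a \<Rightarrow> real) \<Rightarrow> ('a \<Rightarrow> real) \<Rightarrow> real" where
  "hilbert_m C f g = Sup {a. a > 0 \<and> (\<lambda>x. f x - a * g x) \<in> C}"

definition hilbert_dist ::
  "'a measure \<Rightarrow> ('a \<Rightarrow> real) set \<Rightarrow> ('a \<Rightarrow> real) \<Rightarrow> ('a \<Rightarrow> real) \<Rightarrow> ereal" where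
  "hilbert_dist \<rho> C f g =
     (if cone_comparable C f g \<and> \<not> (AE x in \<rho>. g x = 0)
      then ereal (ln (hilbert_M C f g / hilbert_m C f g)) else \<infinity>)"

text \<open>Schroedinger / Sinkhorn operators T_nu and T_mu (1/infinity = 0).\<close>
definition T_nu :: "'a measure \<Rightarrow> ('a \<times> 'a \<Rightarrow> real) \<Rightarrow> real \<Rightarrow> ('a \<Rightarrow> real) \<Rightarrow> 'a \<Rightarrow> real" where
  "T_nu \<nu> c \<epsilon> g x = 1 / enn2real (\<integral>\<^sup>+ y. ennreal (exp (- c (x, y) / \<epsilon>) * g y) \<partial>\<nu>)"

definition T_mu :: "'a measure \<Rightarrow> ('a \<times> 'a \<Rightarrow> real) \<Rightarrow> real \<Rightarrow> ('a \<Rightarrow> real) \<Rightarrow> 'a \<Rightarrow> real" where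
  "T_mu \<mu> c \<epsilon> g y = 1 / enn2real (\<integral>\<^sup>+ x. ennreal (exp (- c (x, y) / \<epsilon>) * g x) \<partial>\<mu>)"

fun sinkhorn ::
  "'a measure \<Rightarrow> 'a measure \<Rightarrow> ('a \<times> 'a \<Rightarrow> real) \<Rightarrow> real \<Rightarrow> nat \<Rightarrow> ('a \<Rightarrow> real) \<times> ('a \<Rightarrow> real)" where
  "sinkhorn \<mu> \<nu> c \<epsilon> 0 = ((\<lambda>_. 1), (\<lambda>_. 1))"
| "sinkhorn \<mu> \<nu> c \<epsilon> (Suc n) =
     (let g1 = T_nu \<nu> c \<epsilon> (snd (sinkhorn \<mu> \<nu> c \<epsilon> n)) in (g1, T_mu \<mu> c \<epsilon> g1))"

text \<open>Density of a coupling w.r.t. mu x nu given by potentials g1, g2.\<close>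
definition coupling_density ::
  "('a \<times> 'a \<Rightarrow> real) \<Rightarrow> real \<Rightarrow> ('a \<Rightarrow> real) \<Rightarrow> ('a \<Rightarrow> real) \<Rightarrow> 'a \<times> 'a \<Rightarrow> real" where
  "coupling_density c \<epsilon> g1 g2 z = exp (- c z / \<epsilon>) * g1 (fst z) * g2 (snd z)"

text \<open>Total variation distance of two couplings given by densities wrt mu x nu (L1 distance).\<close>
definition tv_dist :: "'a measure \<Rightarrow> ('a \<Rightarrow> real) \<Rightarrow> ('a \<Rightarrow> real) \<Rightarrow> ennreal" where
  "tv_dist M p q = (\<integral>\<^sup>+ z. ennreal \<bar>p z - q z\<bar> \<partial>M)"

end

theory Submission
  imports Defs "HOL-Real_Asymp.Real_Asymp"
begin

text \<open>
  Writing s(x) = (K + d(x0,x)^p) / eps, the growth condition gives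
  exp (- s x - s y) <= exp (- c(x,y) / eps) <= 1, and the tail condition makes all exponential
  moments of s finite.

  Monotonicity of the dual objective keeps the integrals of ln g1(n) and ln g2(n) nonnegative, which
  bounds all iterates between a constant and a multiple of exp s, uniformly in n. Let h be the
  difference of ln g2(n) and ln g2*. Jensen's inequality, applied from both sides, squeezes the
  next difference of logarithms between means of h under two Gibbs-tilted Markov kernels. The uniform
  bounds give all these kernels a common minorization on sublevel sets of s and the drift
  K s <= s/2 + C, the latter because s is controlled by the logarithm of the exponential moment
  that the kernel moves by at most exp s. The argument of Hairer and Mattingly for Harris' theorem
  then contracts the oscillation of h relative to 1 + beta s by a fixed factor in each half step.

  Up to a bounded scalar exp q, the iterates therefore converge geometrically in a weighted supremum
  norm. With zero second tail function the elements of the cone F are nonnegative, and for a first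
  tail function that decays fast enough they satisfy a bound of the integral of f exp (2 s) by a
  multiple of the integral of f; the dual cone G then contains every function above a constant that
  dominates its exp (2 s) error, which turns the weighted estimate into one for Hilbert's metric.
  For the total variation distance the scalars disappear because all couplings have mass one.
\<close>

section \<open>Kernels between two exponentials\<close>

text \<open>The kernel \<open>exp (- c / \<epsilon>)\<close> need not have a positive lower bound,
  so on the cone of nonnegative functions Birkhoff's theorem may give no contraction at all. Hence
  logarithmic errors are compared with \<open>1 + \<beta> * s\<close> and not with a constant.
  Potentials are determined only up to multiplying one by a scalar and dividing the other by it.
  Oscillations do not see this scalar, so a contraction estimate cannot by itself keep the iterates
  in a bounded range; the nonnegative integrals of the logarithms fix the scale. The exponents have
  this origin: an admissible function has size \<open>exp s\<close>, its logarithmic error is again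
  at most a multiple of \<open>exp s\<close>, so additive errors have size
  \<open>exp (2 * s)\<close>. The cones live in L2, which asks for the moment of
  \<open>exp (4 * s)\<close>. Here s grows like the power p of the distance, so the tail exponent p
  + \<delta> makes every multiple of s exponentially integrable. Jensen's inequality is always used
  through a tangent line, 1 + z <= exp z or ln z <= z - 1, integrated against the measure at
  hand.\<close>

definition adm :: "'b measure \<Rightarrow> ('b \<Rightarrow> real) \<Rightarrow> real \<Rightarrow> real \<Rightarrow> ('b \<Rightarrow> real) \<Rightarrow> bool" where
  "adm N t l u g \<longleftrightarrow> g \<in> borel_measurable N \<and> 0 < l \<and> (\<forall>y. l \<le> g y \<and> g y \<le> u * exp (t y))"

definition kint :: "'b measure \<Rightarrow> ('a \<Rightarrow> 'b \<Rightarrow> real) \<Rightarrow> ('b \<Rightarrow> real) \<Rightarrow> 'a \<Rightarrow> real" where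
  "kint N k g x = (\<integral>y. k x y * g y \<partial>N)"

text \<open>Common form of \<open>T_nu\<close> and \<open>T_mu\<close>. A divergent integral has
  Bochner value 0 and 1 / 0 = 0, in agreement with \<open>enn2real\<close> sending infinity to
  0.\<close>

definition sch :: "'b measure \<Rightarrow> ('a \<Rightarrow> 'b \<Rightarrow> real) \<Rightarrow> ('b \<Rightarrow> real) \<Rightarrow> 'a \<Rightarrow> real" where
  "sch N k g x = 1 / kint N k g x"

lemma adm_mono: "adm N t l u g \<Longrightarrow> 0 < l' \<Longrightarrow> l' \<le> l \<Longrightarrow> u \<le> u' \<Longrightarrow> adm N t l' u' g"
  unfolding adm_def
  by (meson exp_gt_zero mult_right_mono order.trans less_imp_le)

lemma adm_pos: "adm N t l u g \<Longrightarrow> 0 < g y"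
  unfolding adm_def by (meson less_le_trans)

lemma adm_bound_pos: "adm N t l u g \<Longrightarrow> 0 < u"
proof -
  assume a: "adm N t l u g"
  have "0 < u * exp (t undefined)"
    using a unfolding adm_def by (meson less_le_trans)
  then show ?thesis by (simp add: zero_less_mult_iff)
qed

lemma log_ratio_bound:
  assumes "adm N t l u a" "adm N t l u a'" "\<And>y. 0 \<le> t y"
  shows "\<bar>ln (a y) - ln (a' y)\<bar> \<le> ln (u / l) + t y"
proof -
  have u: "0 < u" and l: "0 < l" using adm_bound_pos[OF assms(1)] assms(1) by (auto simp: adm_def)
  have b: "ln l \<le> ln (g y) \<and> ln (g y) \<le> ln u + t y" if "adm N t l u g" for g
  proof -
    have "ln (g y) \<le> ln (u * exp (t y))"
      using that adm_pos[OF that, of y] u by (subst ln_le_cancel_iff) (auto simp: adm_def)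
    then show ?thesis using that adm_pos[OF that, of y] l u
      by (auto simp: adm_def ln_mult)
  qed
  show ?thesis using b[OF assms(1)] b[OF assms(2)] u l by (auto simp: ln_div abs_le_iff)
qed

locale bounded_kernel =
  M: prob_space M + N: prob_space N for M :: "'a measure" and N :: "'b measure" +
  fixes k :: "'a \<Rightarrow> 'b \<Rightarrow> real" and s :: "'a \<Rightarrow> real" and t :: "'b \<Rightarrow> real"
  assumes space_M: "space M = UNIV" and space_N: "space N = UNIV"
    and k_measurable [measurable]: "case_prod k \<in> borel_measurable (M \<Otimes>\<^sub>M N)"
    and k_le_1: "k x y \<le> 1" and k_ge: "exp (- s x - t y) \<le> k x y"
    and s_measurable [measurable]: "s \<in> borel_measurable M"
    and t_measurable [measurable]: "t \<in> borel_measurable N"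
    and s_nonneg: "0 \<le> s x" and t_nonneg: "0 \<le> t y"
    and s_exp: "integrable M (\<lambda>x. exp (4 * s x))"
    and t_exp: "integrable N (\<lambda>y. exp (4 * t y))"
begin

text \<open>Estimates are proved for one half step only; exchanging the two sides supplies the other
  one.\<close>

lemma dual: "bounded_kernel N M (\<lambda>y x. k x y) t s"
proof -
  have "case_prod (\<lambda>y x. k x y) = (\<lambda>(y,x). case_prod k (x,y))" by auto
  then have "case_prod (\<lambda>y x. k x y) \<in> borel_measurable (N \<Otimes>\<^sub>M M)"
    by (simp add: measurable_pair_swap[OF k_measurable, unfolded comp_def] case_prod_beta')
  moreover have "exp (- t y - s x) \<le> k x y" for x y
    using k_ge[of x y] by (metis diff_conv_add_uminus add.commute)
  ultimately show ?thesis
    by unfold_locales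
      (use space_M space_N k_le_1 s_nonneg t_nonneg s_exp t_exp in auto)
qed

lemma k_pos: "0 < k x y"
  using k_ge[of x y] exp_gt_zero less_le_trans by blast

lemma k_section [measurable]: "k x \<in> borel_measurable N"
  using measurable_Pair2[OF k_measurable, of x] space_M by simp

lemma integrable_exp_boundI:
  assumes "f \<in> borel_measurable N" "\<And>y. \<bar>f y\<bar> \<le> C * exp (4 * t y)"
  shows "integrable N f"
  by (rule Bochner_Integration.integrable_bound[OF integrable_mult_right[OF t_exp, of C] assms(1)])
    (use assms(2) in \<open>auto intro!: AE_I2 order_trans[OF _ abs_ge_self]\<close>)

lemma integrable_exp_boundI_const:
  assumes "f \<in> borel_measurable N" "0 \<le> C" "a \<le> 4" "\<And>y. \<bar>f y\<bar> \<le> C * exp (a * t y)"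
  shows "integrable N f"
proof (rule integrable_exp_boundI[OF assms(1)])
  fix y
  have "C * exp (a * t y) \<le> C * exp (4 * t y)"
    using assms t_nonneg[of y] by (intro mult_left_mono) (auto intro!: mult_right_mono)
  then show "\<bar>f y\<bar> \<le> C * exp (4 * t y)" using assms(4)[of y] by linarith
qed

lemma integrable_exp: "a \<le> 4 \<Longrightarrow> integrable N (\<lambda>y. exp (a * t y))"
  by (rule integrable_exp_boundI_const[of _ 1 a]) auto

lemma integrable_t: "integrable N t"
proof (rule integrable_exp_boundI_const[of _ 1 1])
  fix y show "\<bar>t y\<bar> \<le> 1 * exp (1 * t y)"
    using t_nonneg[of y] exp_ge_add_one_self[of "t y"] by (simp del: exp_ge_add_one_self)
qed auto

lemma adm_measurable: "adm N t l u g \<Longrightarrow> g \<in> borel_measurable N"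
  by (simp add: adm_def)

lemma adm_abs_le: "adm N t l u g \<Longrightarrow> \<bar>g y\<bar> \<le> u * exp (t y)"
  by (smt (verit) adm_def)

text \<open>The exponents add up to three, one from \<open>g\<close> and two from \<open>f\<close>,
  within the four available. Allowing \<open>f\<close> the size \<open>exp (2 * t)\<close> is what
  the drift estimate requires.\<close>

lemma adm_integrable_kernel:
  assumes g: "adm N t l u g" and f: "f \<in> borel_measurable N" "\<And>y. \<bar>f y\<bar> \<le> C * exp (2 * t y)"
  shows "integrable N (\<lambda>y. k x y * g y * f y)"
proof (rule integrable_exp_boundI_const[of _ "u * C" 3])
  have [measurable]: "g \<in> borel_measurable N" "f \<in> borel_measurable N" using g f by (auto simp: adm_def)
  show "(\<lambda>y. k x y * g y * f y) \<in> borel_measurable N" by measurable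
  have u: "0 < u" using adm_bound_pos[OF g] .
  have "0 \<le> C * exp (2 * t undefined)" using f(2)[of undefined] by linarith
  then have "0 \<le> C" by (simp add: zero_le_mult_iff)
  then show "0 \<le> u * C" using u by simp
  fix y
  have "\<bar>k x y * g y * f y\<bar> = k x y * (\<bar>g y\<bar> * \<bar>f y\<bar>)" using k_pos[of x y] by (simp add: abs_mult)
  also have "\<dots> \<le> 1 * (\<bar>g y\<bar> * \<bar>f y\<bar>)" by (intro mult_right_mono k_le_1) auto
  also have "\<dots> \<le> (u * exp (t y)) * (C * exp (2 * t y))"
    using adm_abs_le[OF g, of y] f(2)[of y] u by (simp add: mult_mono)
  also have "\<dots> = u * C * exp (3 * t y)" by (simp add: exp_add[symmetric])
  finally show "\<bar>k x y * g y * f y\<bar> \<le> u * C * exp (3 * t y)" .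
qed simp

abbreviation Z where "Z \<equiv> kint N k"

lemma adm_integrable_Z: "adm N t l u g \<Longrightarrow> integrable N (\<lambda>y. k x y * g y)"
  using adm_integrable_kernel[of l u g "\<lambda>_. 1" 1 x] t_nonneg by simp

lemma adm_integrable: assumes "adm N t l u g" shows "integrable N g"
  by (rule integrable_exp_boundI_const[of _ u 1])
    (use adm_abs_le[OF assms] adm_measurable[OF assms] adm_bound_pos[OF assms] in auto)

lemma adm_integrable_discounted:
  assumes "adm N t l u g" shows "integrable N (\<lambda>y. exp (- t y) * g y)"
proof (rule integrable_exp_boundI_const[of _ u 0])
  show "(\<lambda>y. exp (- t y) * g y) \<in> borel_measurable N" using adm_measurable[OF assms] by measurable
  show "\<bar>exp (- t y) * g y\<bar> \<le> u * exp (0 * t y)" for y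
    using adm_abs_le[OF assms, of y]
    by (simp add: abs_mult exp_minus field_simps)
qed (use adm_bound_pos[OF assms] in auto)

text \<open>Jensen's inequality for \<open>exp (- t)\<close>: integrate 1 + z <= exp z with z the
  mean of \<open>t\<close> minus \<open>t y\<close>.\<close>

lemma discount_pos: "0 < (\<integral>y. exp (- t y) \<partial>N)"
proof -
  have "(\<integral>y. 1 + (- t y) + (\<integral>z. t z \<partial>N) \<partial>N) \<le> (\<integral>y. exp (\<integral>z. t z \<partial>N) * exp (- t y) \<partial>N)"
    using integrable_exp[of "-1"] integrable_t exp_ge_add_one_self[of "(\<integral>z. t z \<partial>N) - t _"]
    by (intro integral_mono) (auto simp: exp_add[symmetric] algebra_simps exp_diff exp_minus divide_inverse)
  then have "1 \<le> exp (\<integral>z. t z \<partial>N) * (\<integral>y. exp (- t y) \<partial>N)"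
    using integrable_t by (simp add: N.prob_space)
  then show ?thesis by (smt (verit) exp_gt_zero mult_nonneg_nonpos)
qed

lemma discounted_ge:
  assumes "adm N t l u g" shows "l * (\<integral>y. exp (- t y) \<partial>N) \<le> (\<integral>y. exp (- t y) * g y \<partial>N)"
proof -
  have "(\<integral>y. l * exp (- t y) \<partial>N) \<le> (\<integral>y. exp (- t y) * g y \<partial>N)"
    using integrable_exp[of "-1"] adm_integrable_discounted[OF assms] assms
    by (intro integral_mono) (auto simp: adm_def mult.commute)
  then show ?thesis by simp
qed

lemma discounted_pos:
  assumes "adm N t l u g" shows "0 < (\<integral>y. exp (- t y) * g y \<partial>N)"
proof -
  have "0 < l * (\<integral>y. exp (- t y) \<partial>N)" using discount_pos assms by (simp add: adm_def)
  then show ?thesis using discounted_ge[OF assms] by linarith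
qed

lemma Z_ge:
  assumes "adm N t l u g" shows "exp (- s x) * (\<integral>y. exp (- t y) * g y \<partial>N) \<le> Z g x"
proof -
  have "exp (- s x) * (\<integral>y. exp (- t y) * g y \<partial>N) = (\<integral>y. exp (- s x) * (exp (- t y) * g y) \<partial>N)" by simp
  also have "\<dots> \<le> Z g x" unfolding kint_def
  proof (rule integral_mono)
    show "exp (- s x) * (exp (- t y) * g y) \<le> k x y * g y" for y
      using mult_right_mono[OF k_ge[of x y], of "g y"] adm_pos[OF assms, of y]
      by (simp add: exp_diff exp_minus divide_inverse mult_ac)
  qed (use adm_integrable_discounted[OF assms] adm_integrable_Z[OF assms] in auto)
  finally show ?thesis .
qed

lemma Z_le: assumes "adm N t l u g" shows "Z g x \<le> (\<integral>y. g y \<partial>N)"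
  unfolding kint_def
  using adm_pos[OF assms] k_le_1 by (intro integral_mono adm_integrable[OF assms] adm_integrable_Z[OF assms])
     (simp add: mult_le_cancel_right)

lemma Z_pos: assumes "adm N t l u g" shows "0 < Z g x"
  using Z_ge[OF assms, of x] discounted_pos[OF assms]
  by (smt (verit) exp_gt_zero mult_pos_pos)

lemma Z_measurable: assumes "adm N t l u g" shows "Z g \<in> borel_measurable M"
proof -
  have [measurable]: "g \<in> borel_measurable N" using adm_measurable[OF assms] .
  show ?thesis unfolding kint_def by measurable
qed

lemma integral_le: assumes "adm N t l u g" shows "(\<integral>y. g y \<partial>N) \<le> u * (\<integral>y. exp (t y) \<partial>N)"
proof -
  have "(\<integral>y. g y \<partial>N) \<le> (\<integral>y. u * exp (t y) \<partial>N)"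
    using integrable_exp[of 1] adm_integrable[OF assms] assms
    by (intro integral_mono) (auto simp: adm_def)
  then show ?thesis by simp
qed

text \<open>The asymmetric shape of \<open>adm\<close> comes from here: an integral against
  \<open>k\<close> lies between a multiple of \<open>exp (- s)\<close> and a constant, so its
  reciprocal lies between a constant and a multiple of \<open>exp s\<close>. The number
  \<open>b\<close> stays free, to be replaced by a bound that does not depend on
  \<open>l\<close>.\<close>

lemma sch_adm:
  assumes g: "adm N t l u g" and b: "b \<le> (\<integral>y. exp (- t y) * g y \<partial>N)" "0 < b"
  shows "adm M s (1 / (u * (\<integral>y. exp (t y) \<partial>N))) (1 / b) (sch N k g)"
  unfolding adm_def
proof (intro conjI allI)
  have u: "0 < u" using adm_bound_pos[OF g] .
  show "sch N k g \<in> borel_measurable M" using Z_measurable[OF g]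
    by (simp add: sch_def[abs_def])
  have Zu: "0 < Z g x" "Z g x \<le> u * (\<integral>y. exp (t y) \<partial>N)" for x
    using Z_pos[OF g] Z_le[OF g, of x] integral_le[OF g] by auto
  have e: "0 < u * (\<integral>y. exp (t y) \<partial>N)" using Zu[of undefined] by linarith
  then show "0 < 1 / (u * (\<integral>y. exp (t y) \<partial>N))" by simp
  fix x
  show "1 / (u * (\<integral>y. exp (t y) \<partial>N)) \<le> sch N k g x"
    unfolding sch_def using Zu[of x] e by (intro divide_left_mono) auto
  have "exp (- s x) * b \<le> Z g x"
    by (rule order_trans[OF mult_left_mono[OF b(1)] Z_ge[OF g]]) simp
  moreover have "0 < exp (- s x) * b" using b by simp
  ultimately have "1 / Z g x \<le> 1 / (exp (- s x) * b)" using Zu[of x]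
    by (intro divide_left_mono) auto
  also have "\<dots> = 1 / b * exp (s x)" by (simp add: exp_minus field_simps)
  finally show "sch N k g x \<le> 1 / b * exp (s x)" unfolding sch_def .
qed

end

section \<open>Uniform bounds on the iterates\<close>

context bounded_kernel begin

lemma adm_ln_integrable:
  assumes g: "adm N t l u g" shows "integrable N (\<lambda>y. ln (g y))"
proof (rule integrable_exp_boundI_const[of _ "\<bar>ln l\<bar> + \<bar>ln u\<bar> + 1" 1])
  have u: "0 < u" and l: "0 < l" using adm_bound_pos[OF g] g by (auto simp: adm_def)
  show "(\<lambda>y. ln (g y)) \<in> borel_measurable N" using adm_measurable[OF g] by measurable
  fix y
  have "ln (g y) \<le> ln (u * exp (t y))"
    using g adm_pos[OF g, of y] u by (subst ln_le_cancel_iff) (auto simp: adm_def)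
  then have "ln l \<le> ln (g y) \<and> ln (g y) \<le> ln u + t y"
    using adm_pos[OF g, of y] u l g by (auto simp: adm_def ln_mult)
  then have "\<bar>ln (g y)\<bar> \<le> \<bar>ln l\<bar> + \<bar>ln u\<bar> + t y" using t_nonneg[of y] by linarith
  also have "\<dots> \<le> (\<bar>ln l\<bar> + \<bar>ln u\<bar>) * exp (t y) + exp (t y)"
    using t_nonneg[of y] exp_ge_add_one_self[of "t y"]
    by (intro add_mono mult_le_cancel_left1[THEN iffD2]) (auto simp del: exp_ge_add_one_self)
  finally show "\<bar>ln (g y)\<bar> \<le> (\<bar>ln l\<bar> + \<bar>ln u\<bar> + 1) * exp (1 * t y)" by (simp add: algebra_simps)
qed auto

text \<open>Jensen's inequality for \<open>exp (ln g - t)\<close>. The bound contains neither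
  \<open>l\<close> nor \<open>u\<close>, hence it does not deteriorate under iteration.\<close>

lemma discounted_ge_exp_integral_ln:
  assumes g: "adm N t l u g" and J: "0 \<le> (\<integral>y. ln (g y) \<partial>N)"
  shows "exp (- (\<integral>y. t y \<partial>N)) \<le> (\<integral>y. exp (- t y) * g y \<partial>N)"
proof -
  define m where "m = (\<integral>y. ln (g y) \<partial>N) - (\<integral>y. t y \<partial>N)"
  have pw: "exp m * (1 + (ln (g y) - t y - m)) \<le> exp (- t y) * g y" for y
  proof -
    have "exp m * (1 + (ln (g y) - t y - m)) \<le> exp m * exp (ln (g y) - t y - m)"
      by (intro mult_left_mono exp_ge_add_one_self) auto
    also have "\<dots> = exp (- t y) * g y"
      using adm_pos[OF g, of y] by (simp add: exp_add[symmetric] exp_diff exp_minus divide_inverse)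
    finally show ?thesis .
  qed
  have "(\<integral>y. exp m * (1 + (ln (g y) - t y - m)) \<partial>N) \<le> (\<integral>y. exp (- t y) * g y \<partial>N)"
    using pw adm_ln_integrable[OF g] integrable_t adm_integrable_discounted[OF g]
    by (intro integral_mono) auto
  moreover have "(\<integral>y. exp m * (1 + (ln (g y) - t y - m)) \<partial>N) = exp m"
    using adm_ln_integrable[OF g] integrable_t by (simp add: N.prob_space m_def)
  moreover have "exp (- (\<integral>y. t y \<partial>N)) \<le> exp m" using J by (simp add: m_def)
  ultimately show ?thesis by linarith
qed

lemma sch_adm_exists:
  assumes "adm N t l u g" shows "\<exists>l u. adm M s l u (sch N k g)"
  using sch_adm[OF assms order.refl discounted_pos[OF assms]] by blast

lemma pair_integrable:
  assumes a: "adm N t l u a" and b: "adm M s l' u' b"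
  shows "integrable (M \<Otimes>\<^sub>M N) (\<lambda>(x,y). k x y * b x * a y)"
proof -
  interpret D: bounded_kernel N M "\<lambda>y x. k x y" t s by (rule dual)
  interpret P: pair_sigma_finite M N ..
  have [measurable]: "a \<in> borel_measurable N" "b \<in> borel_measurable M" using a b by (auto simp: adm_def)
  have "integrable (M \<Otimes>\<^sub>M N) (\<lambda>(x,y). b x * a y)"
  proof (rule P.Fubini_integrable)
    show "integrable M (\<lambda>x. \<integral>y. norm (case (x, y) of (x, y) \<Rightarrow> b x * a y) \<partial>N)"
      using D.adm_integrable[OF b] by (simp add: abs_mult)
    show "AE x in M. integrable N (\<lambda>y. case (x, y) of (x, y) \<Rightarrow> b x * a y)"
      using adm_integrable[OF a] by simp
  qed measurable
  then show ?thesis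
  proof (rule Bochner_Integration.integrable_bound)
    show "(\<lambda>(x, y). k x y * b x * a y) \<in> borel_measurable (M \<Otimes>\<^sub>M N)"
      using k_measurable by measurable
    show "AE z in M \<Otimes>\<^sub>M N. norm (case z of (x, y) \<Rightarrow> k x y * b x * a y) \<le> norm (case z of (x, y) \<Rightarrow> b x * a y)"
    proof (rule AE_I2, clarify)
      fix x y
      have "\<bar>k x y\<bar> * \<bar>b x * a y\<bar> \<le> 1 * \<bar>b x * a y\<bar>"
        using k_pos[of x y] k_le_1[of x y] by (intro mult_right_mono) auto
      then show "norm (k x y * b x * a y) \<le> norm (b x * a y)" by (simp add: abs_mult mult.assoc)
    qed
  qed
qed

text \<open>\<open>sch\<close> normalizes the first marginal: for each x the inner integral over y
  is 1.\<close>

lemma pair_mass: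
  assumes a: "adm N t l u a"
  shows "(\<integral>(x,y). k x y * sch N k a x * a y \<partial>(M \<Otimes>\<^sub>M N)) = 1"
proof -
  interpret D: bounded_kernel N M "\<lambda>y x. k x y" t s by (rule dual)
  interpret P: pair_sigma_finite M N ..
  obtain l' u' where b: "adm M s l' u' (sch N k a)" using sch_adm_exists[OF a] by blast
  have "(\<integral>(x,y). k x y * sch N k a x * a y \<partial>(M \<Otimes>\<^sub>M N)) = (\<integral>x. (\<integral>y. k x y * sch N k a x * a y \<partial>N) \<partial>M)"
    using P.integral_fst'[OF pair_integrable[OF a b]] by simp
  also have "\<dots> = (\<integral>x. 1 \<partial>M)"
  proof (rule Bochner_Integration.integral_cong[OF refl])
    fix x
    have "(\<integral>y. k x y * sch N k a x * a y \<partial>N) = (\<integral>y. sch N k a x * (k x y * a y) \<partial>N)"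
      by (simp add: mult_ac)
    also have "\<dots> = sch N k a x * Z a x" by (simp add: kint_def)
    also have "\<dots> = 1" using Z_pos[OF a, of x] by (simp add: sch_def)
    finally show "(\<integral>y. k x y * sch N k a x * a y \<partial>N) = 1" .
  qed
  finally show ?thesis by (simp add: M.prob_space)
qed

text \<open>The dual objective of entropic transport does not decrease along a Sinkhorn sweep.\<close>
lemma integral_ln_mono:
  assumes a: "adm N t l u a"
  defines "b \<equiv> sch N k a"
  defines "d \<equiv> sch M (\<lambda>y x. k x y) b"
  shows "(\<integral>y. ln (a y) \<partial>N) \<le> (\<integral>y. ln (d y) \<partial>N)"
proof -
  interpret D: bounded_kernel N M "\<lambda>y x. k x y" t s by (rule dual)
  interpret P: pair_sigma_finite M N ..
  obtain l' u' where b: "adm M s l' u' b" using sch_adm_exists[OF a] b_def by blast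
  obtain l'' u'' where d: "adm N t l'' u'' d" using D.sch_adm_exists[OF b] d_def by blast
  \<comment> \<open>\<open>a / d\<close> is the density of the second marginal of the coupling with
    potentials \<open>b\<close> and \<open>a\<close>, so it integrates to one. The inequality
    \<open>ln z <= z - 1\<close> then expresses that relative entropy is nonnegative.\<close>
  have eq: "a y / d y = (\<integral>x. k x y * b x * a y \<partial>M)" for y
  proof -
    have "(\<integral>x. k x y * b x * a y \<partial>M) = kint M (\<lambda>y x. k x y) b y * a y" by (simp add: kint_def)
    then show ?thesis unfolding d_def sch_def by (metis divide_divide_eq_right div_by_1 mult.commute)
  qed
  have i: "integrable N (\<lambda>y. a y / d y)"
    unfolding eq using P.integrable_snd[OF pair_integrable[OF a b]] by simp
  have m: "(\<integral>y. a y / d y \<partial>N) = 1"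
    unfolding eq using P.integral_snd[OF pair_integrable[OF a b]] pair_mass[OF a]
    by (simp add: b_def)
  have "(\<integral>y. 1 - a y / d y \<partial>N) \<le> (\<integral>y. ln (d y) - ln (a y) \<partial>N)"
  proof (rule integral_mono)
    fix y
    have "ln (a y / d y) \<le> a y / d y - 1"
      using adm_pos[OF a, of y] adm_pos[OF d, of y] by (intro ln_le_minus_one) auto
    then show "1 - a y / d y \<le> ln (d y) - ln (a y)"
      using adm_pos[OF a, of y] adm_pos[OF d, of y] by (simp add: ln_div)
  qed (use i adm_ln_integrable[OF a] adm_ln_integrable[OF d] in auto)
  then show ?thesis
    using i m adm_ln_integrable[OF a] adm_ln_integrable[OF d] by (simp add: N.prob_space)
qed

end

section \<open>Contraction of logarithmic oscillations\<close>

text \<open>The signed measure with density p - p' loses mass on the common part r, and only the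
  remaining parts of p and p' see the weight.\<close>
lemma integral_diff_le_weighted:
  fixes p p' r H w :: "'b \<Rightarrow> real"
  assumes int: "integrable N (\<lambda>y. p y * H y)" "integrable N (\<lambda>y. p' y * H y)"
      "integrable N (\<lambda>y. p y * w y)" "integrable N (\<lambda>y. p' y * w y)"
      "integrable N (\<lambda>y. r y * H y)" "integrable N (\<lambda>y. r y * w y)"
    and le: "\<And>y. r y \<le> p y" "\<And>y. r y \<le> p' y" and H: "\<And>y. \<bar>H y\<bar> \<le> w y"
  shows "(\<integral>y. p y * H y \<partial>N) - (\<integral>y. p' y * H y \<partial>N)
    \<le> (\<integral>y. p y * w y \<partial>N) + (\<integral>y. p' y * w y \<partial>N) - 2 * (\<integral>y. r y * w y \<partial>N)"
proof -
  have 1: "(\<integral>y. p y * H y - r y * H y \<partial>N) \<le> (\<integral>y. p y * w y - r y * w y \<partial>N)"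
  proof (rule integral_mono)
    show "p y * H y - r y * H y \<le> p y * w y - r y * w y" for y
      using mult_left_mono[of "H y" "w y" "p y - r y"] le(1)[of y] H[of y] by (simp add: algebra_simps abs_le_iff)
  qed (use int in auto)
  have 2: "(\<integral>y. r y * H y - p' y * H y \<partial>N) \<le> (\<integral>y. p' y * w y - r y * w y \<partial>N)"
  proof (rule integral_mono)
    show "r y * H y - p' y * H y \<le> p' y * w y - r y * w y" for y
      using mult_left_mono[of "- H y" "w y" "p' y - r y"] le(2)[of y] H[of y] by (simp add: algebra_simps abs_le_iff)
  qed (use int in auto)
  show ?thesis using 1 2 int by simp
qed

text \<open>Helly's theorem on the line: the hypothesis says that the intervals from
  \<open>f x - w x\<close> to \<open>f x + w x\<close> meet pairwise, and the supremum of their left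
  ends lies in all of them.\<close>

lemma centre_of_oscillation:
  fixes f w :: "'a \<Rightarrow> real"
  assumes "\<And>x x'. f x - f x' \<le> w x + w x'"
  shows "\<exists>q. \<forall>x. \<bar>f x - q\<bar> \<le> w x"
proof (intro exI allI)
  fix x
  define q where "q = (SUP x. f x - w x)"
  have b: "f x - w x \<le> f x' + w x'" for x x' using assms[of x x'] by linarith
  have "f x - w x \<le> q" unfolding q_def
    by (rule cSUP_upper) (use b in \<open>auto simp: bdd_above_def\<close>)
  moreover have "q \<le> f x + w x" unfolding q_def
    by (rule cSUP_least) (use b in auto)
  ultimately show "\<bar>f x - (SUP x. f x - w x)\<bar> \<le> w x" by (simp add: q_def abs_le_iff)
qed

text \<open>Mean of \<open>f\<close> under the conditional law of y given x in the coupling with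
  potentials \<open>sch N k a\<close> and \<open>a\<close>.\<close>

definition tilted_mean :: "'b measure \<Rightarrow> ('a \<Rightarrow> 'b \<Rightarrow> real) \<Rightarrow> ('b \<Rightarrow> real) \<Rightarrow> 'a \<Rightarrow> ('b \<Rightarrow> real) \<Rightarrow> real" where
  "tilted_mean N k a x f = (\<integral>y. k x y * a y / kint N k a x * f y \<partial>N)"

lemma affine_le_exp: "0 \<le> A \<Longrightarrow> 0 \<le> B \<Longrightarrow> 0 \<le> r \<Longrightarrow> A + B * r \<le> (A + B) * exp r" for r :: real
proof -
  assume r: "0 \<le> A" "0 \<le> B" "0 \<le> r"
  have "(A + B) * (1 + r) \<le> (A + B) * exp r"
    using r by (intro mult_left_mono exp_ge_add_one_self) auto
  moreover have "0 \<le> A * r" using r by auto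
  moreover have "(A + B) * (1 + r) = A + B + A * r + B * r" by (simp add: algebra_simps)
  ultimately show ?thesis using r by linarith
qed

lemma affine_le_exp_double:
  "0 \<le> A \<Longrightarrow> 0 \<le> B \<Longrightarrow> 0 \<le> r \<Longrightarrow> A + B * r \<le> (A + B) * exp (2 * r)" for r :: real
  by (rule order_trans[OF affine_le_exp mult_left_mono]) auto

text \<open>Pairs of far away points are handled by the drift, pairs of near points by the common mass.\<close>
lemma harris_numeric:
  fixes S R C \<alpha> \<beta> \<kappa> :: real
  assumes "0 \<le> S" "8 * C \<le> R" "0 \<le> \<alpha>" "0 < \<beta>" "2 * \<beta> * C \<le> \<alpha>"
    and \<kappa>: "1 - \<alpha> / 2 \<le> \<kappa>" "3 / 4 \<le> \<kappa>" "2 + 3 / 4 * (\<beta> * R) \<le> \<kappa> * (2 + \<beta> * R)"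
  shows "R \<le> S \<Longrightarrow> 2 + \<beta> * (S / 2 + 2 * C) \<le> \<kappa> * (2 + \<beta> * S)"
    and "2 + \<beta> * (S / 2 + 2 * C) - 2 * \<alpha> \<le> \<kappa> * (2 + \<beta> * S)"
proof -
  have bS: "0 \<le> \<beta> * S" using assms by simp
  \<comment> \<open>Half of the gain \<open>2 * \<alpha>\<close> pays for the drift constant; the
    other half allows a factor as small as \<open>1 - \<alpha> / 2\<close>.\<close>
  show "2 + \<beta> * (S / 2 + 2 * C) - 2 * \<alpha> \<le> \<kappa> * (2 + \<beta> * S)"
  proof -
    have "2 + \<beta> * (S / 2 + 2 * C) - 2 * \<alpha> = 2 + \<beta> * S / 2 + 2 * \<beta> * C - 2 * \<alpha>"
      "\<kappa> * (2 + \<beta> * S) = 2 * \<kappa> + \<kappa> * (\<beta> * S)" by (simp_all add: algebra_simps)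
    then show ?thesis using mult_right_mono[OF \<kappa>(2) bS] assms(5) \<kappa>(1) bS by linarith
  qed
  assume RS: "R \<le> S"
  \<comment> \<open>For far pairs \<open>2 * C\<close> is at most \<open>S / 4\<close>, which raises
    the slope from 1/2 to 3/4 and still leaves room below one.\<close>
  have "\<beta> * (8 * C) \<le> \<beta> * S" using assms RS by (intro mult_left_mono) auto
  then have "2 + \<beta> * (S / 2 + 2 * C) \<le> (2 + 3 / 4 * (\<beta> * R)) + 3 / 4 * (\<beta> * S - \<beta> * R)"
    by (simp add: field_simps)
  also have "\<dots> \<le> \<kappa> * (2 + \<beta> * R) + \<kappa> * (\<beta> * S - \<beta> * R)"
    using assms RS by (intro add_mono mult_right_mono) auto
  also have "\<dots> = \<kappa> * (2 + \<beta> * S)" by (simp add: algebra_simps)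
  finally show "2 + \<beta> * (S / 2 + 2 * C) \<le> \<kappa> * (2 + \<beta> * S)" .
qed

section \<open>Gibbs-tilted kernels: Jensen, drift, minorization, contraction\<close>

context bounded_kernel begin

lemma tilted_integrable:
  assumes a: "adm N t l u a" and f: "f \<in> borel_measurable N" "\<And>y. \<bar>f y\<bar> \<le> A + B * t y" "0 \<le> A" "0 \<le> B"
  shows "integrable N (\<lambda>y. k x y * a y / Z a x * f y)"
proof -
  have "integrable N (\<lambda>y. k x y * a y * f y)"
    by (rule adm_integrable_kernel[OF a f(1), of "A + B"])
       (use f t_nonneg affine_le_exp_double[of A B] in \<open>meson order_trans\<close>)
  then have "integrable N (\<lambda>y. k x y * a y * f y / Z a x)" by simp
  then show ?thesis by simp
qed

lemma tilted_mass:
  assumes a: "adm N t l u a"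
  shows "integrable N (\<lambda>y. k x y * a y / Z a x)" "(\<integral>y. k x y * a y / Z a x \<partial>N) = 1"
  using adm_integrable_Z[OF a, of x] Z_pos[OF a, of x] by (auto simp: kint_def)

text \<open>Stated for \<open>p + q * f y\<close> so that a shift by a constant, a change of sign
  and the evaluation of the weight are instances of one rule.\<close>

lemma tilted_mean_affine:
  assumes a: "adm N t l u a" and f: "f \<in> borel_measurable N" "\<And>y. \<bar>f y\<bar> \<le> A + B * t y" "0 \<le> A" "0 \<le> B"
  shows "tilted_mean N k a x (\<lambda>y. p + q * f y) = p + q * tilted_mean N k a x f"
proof -
  have "tilted_mean N k a x (\<lambda>y. p + q * f y)
      = (\<integral>y. p * (k x y * a y / Z a x) + q * (k x y * a y / Z a x * f y) \<partial>N)"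
    unfolding tilted_mean_def by (intro Bochner_Integration.integral_cong) (auto simp: algebra_simps add_divide_distrib)
  also have "\<dots> = p * (\<integral>y. k x y * a y / Z a x \<partial>N) + q * tilted_mean N k a x f"
    unfolding tilted_mean_def
    by (subst Bochner_Integration.integral_add)
       (use tilted_mass(1)[OF a, of x] tilted_integrable[OF a f, of x]
         in \<open>auto intro!: integrable_mult_right simp del: times_divide_eq_right times_divide_eq_left\<close>)
  finally show ?thesis by (simp only: tilted_mass(2)[OF a] mult_1_right)
qed

lemma log_ratio_measurable:
  assumes "adm N t l u a" "adm N t l u a'"
  shows "(\<lambda>y. ln (a y) - ln (a' y)) \<in> borel_measurable N"
  using adm_measurable[OF assms(1)] adm_measurable[OF assms(2)] by measurable

lemma log_ratio_affine:
  assumes "adm N t l u a" "adm N t l u a'"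
  shows "\<bar>ln (a y) - ln (a' y)\<bar> \<le> \<bar>ln (u / l)\<bar> + 1 * t y"
  using log_ratio_bound[OF assms t_nonneg, of y] by linarith

text \<open>With h the difference of the logarithms, \<open>Z a' x / Z a x\<close> is the tilted
  mean of \<open>exp (- h)\<close>, so Jensen's inequality applies. Exchanging \<open>a\<close> and
  \<open>a'\<close> gives the reverse bound, with the mean tilted by \<open>a'\<close>.\<close>

lemma ln_Z_diff_le:
  assumes a: "adm N t l u a" and a': "adm N t l u a'"
  shows "ln (Z a x) - ln (Z a' x) \<le> tilted_mean N k a x (\<lambda>y. ln (a y) - ln (a' y))"
proof -
  let ?h = "\<lambda>y. ln (a y) - ln (a' y)"
  define m where "m = tilted_mean N k a x ?h"
  note aff = log_ratio_measurable[OF a a'] log_ratio_affine[OF a a']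
  have 1: "k x y * a y / Z a x * (exp (- m) * (1 + m + (-1) * ?h y)) \<le> k x y * a' y / Z a x" for y
  proof -
    have "exp (- m) * (1 + m + (-1) * ?h y) \<le> exp (- m) * exp (m - ?h y)"
      using exp_ge_add_one_self[of "m - ?h y"] by (intro mult_left_mono) (auto simp: algebra_simps)
    also have "\<dots> = a' y / a y"
      using adm_pos[OF a, of y] adm_pos[OF a', of y]
      by (simp add: exp_add[symmetric] exp_diff)
    finally have "k x y * a y / Z a x * (exp (- m) * (1 + m + (-1) * ?h y)) \<le> k x y * a y / Z a x * (a' y / a y)"
      using Z_pos[OF a, of x] adm_pos[OF a, of y] k_pos[of x y] by (intro mult_left_mono) auto
    then show ?thesis using adm_pos[OF a, of y] by simp
  qed
  have i1: "integrable N (\<lambda>y. k x y * a y / Z a x * (1 + m + (-1) * ?h y))"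
  proof (rule tilted_integrable[OF a])
    show "\<bar>1 + m + (-1) * ?h y\<bar> \<le> (\<bar>1 + m\<bar> + \<bar>ln (u / l)\<bar>) + 1 * t y" for y
      using aff(2)[of y] abs_triangle_ineq4[of "1 + m" "?h y"] by simp
    show "(\<lambda>y. 1 + m + (-1) * ?h y) \<in> borel_measurable N" using aff(1) by (intro borel_measurable_add borel_measurable_times) auto
  qed auto
  have "exp (- m) = exp (- m) * tilted_mean N k a x (\<lambda>y. 1 + m + (-1) * ?h y)"
    by (subst tilted_mean_affine[OF a aff]) (auto simp: m_def)
  also have "\<dots> = (\<integral>y. k x y * a y / Z a x * (exp (- m) * (1 + m + (-1) * ?h y)) \<partial>N)"
    unfolding tilted_mean_def by (subst integral_mult_right_zero[symmetric]) (simp add: mult_ac)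
  also have "\<dots> \<le> (\<integral>y. k x y * a' y / Z a x \<partial>N)"
    by (rule integral_mono)
       (use integrable_mult_right[OF i1, of "exp (- m)"] 1 adm_integrable_Z[OF a', of x] in \<open>auto simp: mult_ac\<close>)
  also have "\<dots> = Z a' x / Z a x" by (simp add: kint_def)
  finally have "- m \<le> ln (Z a' x / Z a x)"
    using Z_pos[OF a, of x] Z_pos[OF a', of x] by (subst ln_ge_iff) auto
  then show ?thesis using Z_pos[OF a, of x] Z_pos[OF a', of x] by (simp add: ln_div m_def)
qed

text \<open>The tilted mean of \<open>exp (2 * t)\<close> is at most \<open>exp m\<close> with
  \<open>m = s x + 2 * C\<close>, because the normalization \<open>Z a x\<close> can be small only
  like \<open>exp (- s x)\<close>. Jensen's inequality bounds the mean of \<open>2 * t\<close> by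
  \<open>m\<close>; the 2 in the exponent is the origin of the drift factor 1/2.\<close>

lemma tilted_drift:
  assumes a: "adm N t l u a" and C: "u * (\<integral>y. exp (3 * t y) \<partial>N) \<le> exp (2 * C) * (l * (\<integral>y. exp (- t y) \<partial>N))"
  shows "tilted_mean N k a x t \<le> s x / 2 + C"
proof -
  define m where "m = s x + 2 * C"
  have u: "0 < u" using adm_bound_pos[OF a] .
  have Zp: "0 < Z a x" by (rule Z_pos[OF a])
  have i2: "integrable N (\<lambda>y. k x y * a y * exp (2 * t y))"
    by (rule adm_integrable_kernel[OF a, of _ 1]) auto
  have it: "integrable N (\<lambda>y. k x y * a y * t y)"
  proof (rule adm_integrable_kernel[OF a, of _ 1])
    show "\<bar>t y\<bar> \<le> 1 * exp (2 * t y)" for y using affine_le_exp_double[of 0 1 "t y"] t_nonneg[of y] by simp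
  qed simp
  have "(\<integral>y. k x y * a y * exp (2 * t y) \<partial>N) \<le> (\<integral>y. u * exp (3 * t y) \<partial>N)"
  proof (rule integral_mono[OF i2])
    fix y
    have "k x y * a y * exp (2 * t y) \<le> 1 * (u * exp (t y)) * exp (2 * t y)"
      using k_le_1[of x y] adm_pos[OF a, of y] a u by (intro mult_right_mono mult_mono) (auto simp: adm_def)
    also have "\<dots> = u * exp (3 * t y)" by (simp add: exp_add[symmetric])
    finally show "k x y * a y * exp (2 * t y) \<le> u * exp (3 * t y)" .
  qed (use integrable_exp[of 3] in auto)
  also have "\<dots> \<le> exp (2 * C) * (l * (\<integral>y. exp (- t y) \<partial>N))" using C by simp
  also have "\<dots> \<le> exp (2 * C) * (exp (s x) * Z a x)"
  proof (rule mult_left_mono)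
    have "l * (\<integral>y. exp (- t y) \<partial>N) \<le> exp (s x) * (exp (- s x) * (\<integral>y. exp (- t y) * a y \<partial>N))"
      using discounted_ge[OF a] by (simp add: mult.assoc[symmetric] exp_add[symmetric])
    also have "\<dots> \<le> exp (s x) * Z a x" using Z_ge[OF a, of x] by (intro mult_left_mono) auto
    finally show "l * (\<integral>y. exp (- t y) \<partial>N) \<le> exp (s x) * Z a x" .
  qed simp
  also have "\<dots> = exp m * Z a x" by (simp add: m_def exp_add)
  finally have e2: "(\<integral>y. k x y * a y * exp (2 * t y) \<partial>N) \<le> exp m * Z a x" .
  have "(\<integral>y. 2 * (k x y * a y * t y) \<partial>N) \<le> (\<integral>y. (m - 1) * (k x y * a y) + exp (- m) * (k x y * a y * exp (2 * t y)) \<partial>N)"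
  proof (rule integral_mono)
    fix y
    \<comment> \<open>Tangent line of the exponential at \<open>m\<close>.\<close>
    have "2 * t y \<le> (m - 1) + exp (- m) * exp (2 * t y)"
    proof -
      have "exp (- m) * exp (2 * t y) = exp (2 * t y - m)" by (simp add: exp_add[symmetric])
      moreover have "1 + (2 * t y - m) \<le> exp (2 * t y - m)" by (rule exp_ge_add_one_self)
      ultimately show ?thesis by linarith
    qed
    then have "(k x y * a y) * (2 * t y) \<le> (k x y * a y) * ((m - 1) + exp (- m) * exp (2 * t y))"
      using k_pos[of x y] adm_pos[OF a, of y] by (intro mult_left_mono) auto
    then show "2 * (k x y * a y * t y) \<le> (m - 1) * (k x y * a y) + exp (- m) * (k x y * a y * exp (2 * t y))"
      by (simp add: algebra_simps)
  qed (use it i2 adm_integrable_Z[OF a, of x] in auto)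
  also have "\<dots> = (m - 1) * Z a x + exp (- m) * (\<integral>y. k x y * a y * exp (2 * t y) \<partial>N)"
    using i2 adm_integrable_Z[OF a, of x] by (simp add: kint_def)
  also have "\<dots> \<le> (m - 1) * Z a x + exp (- m) * (exp m * Z a x)"
    using e2 by (intro add_left_mono mult_left_mono) auto
  also have "\<dots> = m * Z a x" by (simp add: exp_minus algebra_simps)
  finally have "2 * (\<integral>y. k x y * a y * t y \<partial>N) \<le> m * Z a x" by simp
  then have "(\<integral>y. k x y * a y * t y \<partial>N) / Z a x \<le> m / 2" using Zp by (simp add: field_simps)
  moreover have "tilted_mean N k a x t = (\<integral>y. k x y * a y * t y \<partial>N) / Z a x"
    by (simp add: tilted_mean_def)
  ultimately show ?thesis by (simp add: m_def add_divide_distrib)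
qed

text \<open>The profile \<open>exp (- t)\<close> and its coefficient depend neither on
  \<open>x\<close> nor on the choice of \<open>a\<close> between the given bounds, so the same
  minorant works for two tilts at two points.\<close>

lemma tilted_minorization:
  assumes a: "adm N t l u a" and R: "s x \<le> R"
  shows "exp (- R) * l / (u * (\<integral>y. exp (t y) \<partial>N)) * exp (- t y) \<le> k x y * a y / Z a x"
proof -
  have l: "0 < l" using a by (simp add: adm_def)
  have zz: "0 < Z a x" "Z a x \<le> u * (\<integral>y. exp (t y) \<partial>N)"
    using Z_pos[OF a, of x] Z_le[OF a, of x] integral_le[OF a] by auto
  have "exp (- R) * exp (- t y) \<le> exp (- s x - t y)" using R by (simp add: exp_add[symmetric])
  also have "\<dots> \<le> k x y" by (rule k_ge)
  finally have "exp (- R) * exp (- t y) * l \<le> k x y * a y"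
    using a l k_pos[of x y] by (intro mult_mono) (auto simp: adm_def)
  then have "exp (- R) * exp (- t y) * l / (u * (\<integral>y. exp (t y) \<partial>N)) \<le> k x y * a y / Z a x"
    using zz l k_pos[of x y] adm_pos[OF a, of y] by (intro frac_le) (auto simp: less_imp_le)
  then show ?thesis by (simp add: mult_ac)
qed

text \<open>The kernels at the two points are tilted by different functions; this is harmless
  because drift and minorization are uniform over \<open>adm N t l u\<close>. The constants enter
  through inequalities only, so that one choice can serve both half steps.\<close>

lemma sch_contraction:
  assumes a: "adm N t l u a" and a': "adm N t l u a'"
    and H: "\<And>y. \<bar>ln (a y) - ln (a' y) - q\<bar> \<le> \<eta> * (1 + \<beta> * t y)"
    and I: "(\<integral>y. exp (3 * t y) \<partial>N) \<le> I" and J: "J \<le> (\<integral>y. exp (- t y) \<partial>N)"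
    and C: "u * I \<le> exp (2 * C) * (l * J)"
    and \<alpha>: "\<alpha> * (u * I) \<le> exp (- R) * l * J" "0 \<le> \<alpha>"
    and num: "8 * C \<le> R" "0 < \<beta>" "2 * \<beta> * C \<le> \<alpha>"
      "1 - \<alpha> / 2 \<le> \<kappa>" "3 / 4 \<le> \<kappa>" "2 + 3 / 4 * (\<beta> * R) \<le> \<kappa> * (2 + \<beta> * R)"
  shows "\<exists>q'. \<forall>x. \<bar>ln (sch N k a x) - ln (sch N k a' x) - q'\<bar> \<le> \<kappa> * \<eta> * (1 + \<beta> * s x)"
proof (rule centre_of_oscillation)
  \<comment> \<open>The points are named in reverse order because the logarithm of
    \<open>sch\<close> is minus that of \<open>Z\<close>: the oscillation from x' to x in the goal
    is that of \<open>ln Z\<close> from x to x'.\<close>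
  fix x' x
  let ?h = "\<lambda>y. ln (a y) - ln (a' y)"
  let ?w = "\<lambda>y. \<eta> + (\<eta> * \<beta>) * t y"
  have u: "0 < u" and l: "0 < l" using adm_bound_pos[OF a] a by (auto simp: adm_def)
  have "0 \<le> \<eta> * (1 + \<beta> * t undefined)" using H[of undefined] by linarith
  then have lam: "0 \<le> \<eta>" using t_nonneg[of undefined] num(2)
    by (smt (verit) mult_nonneg_nonneg mult_neg_pos)
  have Hw: "\<bar>- q + 1 * ?h y\<bar> \<le> ?w y" for y using H[of y] by (simp add: algebra_simps)
  note aff = log_ratio_measurable[OF a a'] log_ratio_affine[OF a a']
  have C': "u * (\<integral>y. exp (3 * t y) \<partial>N) \<le> exp (2 * C) * (l * (\<integral>y. exp (- t y) \<partial>N))"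
  proof -
    have "u * (\<integral>y. exp (3 * t y) \<partial>N) \<le> u * I" using I u by simp
    also note C
    also have "exp (2 * C) * (l * J) \<le> exp (2 * C) * (l * (\<integral>y. exp (- t y) \<partial>N))" using J l by simp
    finally show ?thesis .
  qed
  have tb: "\<bar>t y\<bar> \<le> 0 + 1 * t y" for y using t_nonneg[of y] by simp
  let ?S = "s x + s x'"
  \<comment> \<open>Valid for any common minorant r. Far pairs take r = 0 and rely on the drift;
    near pairs take \<open>\<zeta> * exp (- t y)\<close>.\<close>
  have key: "tilted_mean N k a x (\<lambda>y. - q + 1 * ?h y) - tilted_mean N k a' x' (\<lambda>y. - q + 1 * ?h y)
     \<le> \<eta> * (2 + \<beta> * (?S / 2 + 2 * C)) - 2 * (\<integral>y. r y * ?w y \<partial>N)"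
    if r: "integrable N (\<lambda>y. r y * (- q + 1 * ?h y))" "integrable N (\<lambda>y. r y * ?w y)"
      "\<And>y. r y \<le> k x y * a y / Z a x" "\<And>y. r y \<le> k x' y * a' y / Z a' x'" for r
  proof -
    have Hm: "(\<lambda>y. - q + 1 * ?h y) \<in> borel_measurable N" using aff(1) by auto
    have lb: "0 \<le> \<eta> * \<beta>" using lam num by simp
    have wb: "\<bar>?w y\<bar> \<le> \<eta> + (\<eta> * \<beta>) * t y" for y using lam lb t_nonneg[of y] by simp
    have wm: "?w \<in> borel_measurable N" by simp
    have "tilted_mean N k a x (\<lambda>y. - q + 1 * ?h y) - tilted_mean N k a' x' (\<lambda>y. - q + 1 * ?h y)
      \<le> tilted_mean N k a x ?w + tilted_mean N k a' x' ?w - 2 * (\<integral>y. r y * ?w y \<partial>N)"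
      unfolding tilted_mean_def
      by (rule integral_diff_le_weighted)
         (rule tilted_integrable[OF a Hm Hw lam lb] tilted_integrable[OF a' Hm Hw lam lb]
            tilted_integrable[OF a wm wb lam lb] tilted_integrable[OF a' wm wb lam lb] r Hw)+
    also have "tilted_mean N k a x ?w = \<eta> + (\<eta> * \<beta>) * tilted_mean N k a x t"
      by (rule tilted_mean_affine[OF a _ tb]) auto
    also have "tilted_mean N k a' x' ?w = \<eta> + (\<eta> * \<beta>) * tilted_mean N k a' x' t"
      by (rule tilted_mean_affine[OF a' _ tb]) auto
    also have "\<eta> + (\<eta> * \<beta>) * tilted_mean N k a x t + (\<eta> + (\<eta> * \<beta>) * tilted_mean N k a' x' t)
      \<le> \<eta> + (\<eta> * \<beta>) * (s x / 2 + C) + (\<eta> + (\<eta> * \<beta>) * (s x' / 2 + C))"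
      using lb tilted_drift[OF a C', of x] tilted_drift[OF a' C', of x']
      by (intro add_mono mult_left_mono) auto
    also have "\<dots> = \<eta> * (2 + \<beta> * (?S / 2 + 2 * C))" by (simp add: algebra_simps)
    finally show ?thesis by simp
  qed
  have main: "tilted_mean N k a x (\<lambda>y. - q + 1 * ?h y) - tilted_mean N k a' x' (\<lambda>y. - q + 1 * ?h y)
     \<le> \<eta> * (\<kappa> * (2 + \<beta> * ?S))"
  proof (cases "R \<le> ?S")
    case True
    have "2 + \<beta> * (?S / 2 + 2 * C) \<le> \<kappa> * (2 + \<beta> * ?S)"
      using harris_numeric(1)[of ?S C R \<alpha> \<beta> \<kappa>] s_nonneg[of x] s_nonneg[of x'] num \<alpha>(2) True by auto
    from mult_left_mono[OF this lam] show ?thesis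
      using key[of "\<lambda>_. 0"] k_pos adm_pos[OF a] adm_pos[OF a'] Z_pos[OF a] Z_pos[OF a']
      by (auto simp: less_imp_le)
  next
    case False
    then have R: "s x \<le> R" "s x' \<le> R" using s_nonneg[of x] s_nonneg[of x'] by auto
    \<comment> \<open>Coefficient of the minorization. The mass of
      \<open>\<zeta> * exp (- t)\<close> is at least \<open>\<alpha>\<close>, and the weight is at
      least \<open>\<eta>\<close>, so removing the common part gains
      \<open>2 * \<eta> * \<alpha>\<close>.\<close>
    define \<zeta> where "\<zeta> = exp (- R) * l / (u * (\<integral>y. exp (t y) \<partial>N))"
    have pI: "0 < (\<integral>y. exp (t y) \<partial>N)"
      using Z_pos[OF a, of x] Z_le[OF a, of x] integral_le[OF a] u by (smt (verit) mult_nonneg_nonpos)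
    have "(\<integral>y. exp (t y) \<partial>N) \<le> (\<integral>y. exp (3 * t y) \<partial>N)"
      using integrable_exp[of 1] integrable_exp[of 3] t_nonneg by (intro integral_mono) auto
    then have II: "(\<integral>y. exp (t y) \<partial>N) \<le> I" using I by simp
    have z0: "0 \<le> \<zeta>" using u l pI by (simp add: \<zeta>_def)
    have "\<alpha> * (u * (\<integral>y. exp (t y) \<partial>N)) \<le> \<alpha> * (u * I)" using II u \<alpha>(2) by (intro mult_left_mono) auto
    also note \<alpha>(1)
    also have "exp (- R) * l * J \<le> exp (- R) * l * (\<integral>y. exp (- t y) \<partial>N)" using J l by simp
    finally have az: "\<alpha> \<le> \<zeta> * (\<integral>y. exp (- t y) \<partial>N)"
      using u pI by (simp add: \<zeta>_def field_simps)
    have lb: "0 \<le> \<eta> * \<beta>" using lam num by simp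
    have wexp: "?w y \<le> (\<eta> + \<eta> * \<beta>) * exp (2 * t y)" for y
      using affine_le_exp_double[OF lam lb t_nonneg] .
    have small: "\<bar>\<zeta> * exp (- t y) * f\<bar> \<le> (\<zeta> * (\<eta> + \<eta> * \<beta>)) * exp (1 * t y)" if "\<bar>f\<bar> \<le> ?w y" for f y
    proof -
      have "\<bar>\<zeta> * exp (- t y) * f\<bar> = \<zeta> * exp (- t y) * \<bar>f\<bar>" using z0 by (simp add: abs_mult)
      also have "\<dots> \<le> \<zeta> * exp (- t y) * ((\<eta> + \<eta> * \<beta>) * exp (2 * t y))"
        using that wexp[of y] z0 by (intro mult_left_mono) auto
      also have "\<dots> = (\<zeta> * (\<eta> + \<eta> * \<beta>)) * (exp (- t y) * exp (2 * t y))" by simp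
      finally show ?thesis by (simp add: exp_add[symmetric])
    qed
    have c0: "0 \<le> \<zeta> * (\<eta> + \<eta> * \<beta>)" using z0 lam lb by simp
    have r1: "integrable N (\<lambda>y. \<zeta> * exp (- t y) * (- q + 1 * ?h y))"
      by (rule integrable_exp_boundI_const[OF _ c0, of _ 1]) (use small Hw aff(1) in \<open>auto simp del: mult_1\<close>)
    have r2: "integrable N (\<lambda>y. \<zeta> * exp (- t y) * ?w y)"
      by (rule integrable_exp_boundI_const[OF _ c0, of _ 1]) (use small lam lb t_nonneg in auto)
    have "\<eta> * \<alpha> \<le> \<eta> * (\<zeta> * (\<integral>y. exp (- t y) \<partial>N))" using az lam by (intro mult_left_mono) auto
    also have "\<dots> = (\<integral>y. \<zeta> * exp (- t y) * \<eta> \<partial>N)" by simp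
    also have "\<dots> \<le> (\<integral>y. \<zeta> * exp (- t y) * ?w y \<partial>N)"
      using r2 z0 lb t_nonneg integrable_exp[of "-1"] by (intro integral_mono mult_left_mono) auto
    finally have "\<eta> * \<alpha> \<le> (\<integral>y. \<zeta> * exp (- t y) * ?w y \<partial>N)" .
    moreover have "\<eta> * (2 + \<beta> * (?S / 2 + 2 * C) - 2 * \<alpha>) \<le> \<eta> * (\<kappa> * (2 + \<beta> * ?S))"
      using harris_numeric(2)[of ?S C R \<alpha> \<beta> \<kappa>] s_nonneg[of x] s_nonneg[of x'] num \<alpha>(2) lam
      by (intro mult_left_mono) auto
    ultimately show ?thesis
      using key[of "\<lambda>y. \<zeta> * exp (- t y)", OF r1 r2
        tilted_minorization[OF a R(1), folded \<zeta>_def] tilted_minorization[OF a' R(2), folded \<zeta>_def]]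
      by (simp add: algebra_simps)
  qed
  have "tilted_mean N k a' x' (\<lambda>y. ln (a' y) - ln (a y)) = tilted_mean N k a' x' (\<lambda>y. 0 + (- 1) * ?h y)"
    by simp
  also have "\<dots> = - tilted_mean N k a' x' ?h"
    by (subst tilted_mean_affine[OF a' aff]) auto
  finally have "ln (Z a x) - ln (Z a' x) - (ln (Z a x') - ln (Z a' x')) \<le>
     tilted_mean N k a x ?h - tilted_mean N k a' x' ?h"
    using ln_Z_diff_le[OF a a', of x] ln_Z_diff_le[OF a' a, of x'] by linarith
  also have "\<dots> = tilted_mean N k a x (\<lambda>y. - q + 1 * ?h y) - tilted_mean N k a' x' (\<lambda>y. - q + 1 * ?h y)"
    by (subst tilted_mean_affine[OF a aff], simp, simp, subst tilted_mean_affine[OF a' aff]) auto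
  also note main
  also have "\<eta> * (\<kappa> * (2 + \<beta> * ?S)) = \<kappa> * \<eta> * (1 + \<beta> * s x') + \<kappa> * \<eta> * (1 + \<beta> * s x)"
    by (simp add: algebra_simps)
  moreover have ln_sch: "ln (sch N k b z) = - ln (Z b z)" if "adm N t l u b" for b z
    using Z_pos[OF that, of z] by (simp add: sch_def ln_div)
  ultimately show "ln (sch N k a x') - ln (sch N k a' x') - (ln (sch N k a x) - ln (sch N k a' x))
     \<le> \<kappa> * \<eta> * (1 + \<beta> * s x') + \<kappa> * \<eta> * (1 + \<beta> * s x)"
    by (simp add: ln_sch[OF a] ln_sch[OF a'])
qed

end

section \<open>Geometric convergence in weighted norm\<close>

lemma abs_exp_diff_le:
  fixes p r :: real assumes "exp p \<le> m" "exp r \<le> m"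
  shows "\<bar>exp p - exp r\<bar> \<le> m * \<bar>p - r\<bar>"
proof -
  have "exp p - exp r \<le> m * \<bar>p - r\<bar>" if "exp p \<le> m" for p r :: real
  proof -
    have "exp p * (1 + (r - p)) \<le> exp p * exp (r - p)"
      by (intro mult_left_mono exp_ge_add_one_self) auto
    then have "exp p - exp r \<le> exp p * (p - r)" by (simp add: exp_add[symmetric] algebra_simps)
    also have "\<dots> \<le> exp p * \<bar>p - r\<bar>" by (intro mult_left_mono) auto
    also have "\<dots> \<le> m * \<bar>p - r\<bar>" using that by (intro mult_right_mono) auto
    finally show ?thesis .
  qed
  from this[OF assms(1), of r] this[OF assms(2), of p] show ?thesis by (simp add: abs_minus_commute abs_le_iff)
qed

context bounded_kernel begin

text \<open>The new upper bound comes from the logarithmic integral and the new lower bound from the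
  old upper bound \<open>U\<close>. Neither involves the old \<open>l\<close>, so the same
  \<open>L\<close> and \<open>U\<close> are reproduced at every step.\<close>

lemma sch_uniform:
  assumes g: "adm N t l U g" and J: "0 \<le> (\<integral>y. ln (g y) \<partial>N)"
    and L: "0 < L" "L \<le> 1 / (U * (\<integral>y. exp (t y) \<partial>N))" and U: "exp (\<integral>y. t y \<partial>N) \<le> U"
  shows "adm M s L U (sch N k g)"
proof (rule adm_mono[OF sch_adm[OF g discounted_ge_exp_integral_ln[OF g J]]])
  show "1 / exp (- (\<integral>y. t y \<partial>N)) \<le> U" using U by (simp add: exp_minus inverse_eq_divide)
qed (use L in auto)

lemma exp_integral_pos: "0 < (\<integral>y. exp (t y) \<partial>N)"
proof -
  have "(\<integral>y. 1 \<partial>N) \<le> (\<integral>y. exp (t y) \<partial>N)"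
    using integrable_exp[of 1] t_nonneg by (intro integral_mono) auto
  then show ?thesis by (simp add: N.prob_space)
qed

lemma sinkhorn_bounds:
  fixes a :: "nat \<Rightarrow> 'a \<Rightarrow> real" and b :: "nat \<Rightarrow> 'b \<Rightarrow> real"
  assumes a0: "a 0 = (\<lambda>_. 1)" and b0: "b 0 = (\<lambda>_. 1)"
    and aS: "\<And>n. a (Suc n) = sch N k (b n)" and bS: "\<And>n. b (Suc n) = sch M (\<lambda>y x. k x y) (a (Suc n))"
  shows "\<exists>l u. \<forall>n. adm M s l u (a n) \<and> adm N t l u (b n)"
proof -
  interpret D: bounded_kernel N M "\<lambda>y x. k x y" t s by (rule dual)
  \<comment> \<open>The two entries are the upper bounds that \<open>sch_uniform\<close> yields on
    the two sides. \<open>U >= 1\<close> and \<open>L <= 1\<close> make the initial constants 1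
    admissible too.\<close>
  define U where "U = max (exp (\<integral>y. t y \<partial>N)) (exp (\<integral>x. s x \<partial>M))"
  define L where "L = min 1 (min (1 / (U * (\<integral>y. exp (t y) \<partial>N))) (1 / (U * (\<integral>x. exp (s x) \<partial>M))))"
  have U1: "1 \<le> U"
  proof -
    have "0 \<le> (\<integral>y. t y \<partial>N)" using t_nonneg by (intro integral_nonneg_AE) auto
    then show ?thesis by (auto simp: U_def le_max_iff_disj)
  qed
  have L: "0 < L" "L \<le> 1" "L \<le> 1 / (U * (\<integral>y. exp (t y) \<partial>N))" "L \<le> 1 / (U * (\<integral>x. exp (s x) \<partial>M))"
    using exp_integral_pos D.exp_integral_pos U1 by (auto simp: L_def)
  have one_le: "1 \<le> U * exp r" if "0 \<le> r" for r
    using mult_mono[of 1 U 1 "exp r"] U1 that by simp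
  have b0': "adm N t L U (b 0)" and a0': "adm M s L U (a 0)"
    using L U1 one_le t_nonneg s_nonneg by (auto simp: adm_def a0 b0)
  have P: "adm N t L U (b n) \<and> 0 \<le> (\<integral>y. ln (b n y) \<partial>N) \<and>
      adm M s L U (a (Suc n)) \<and> 0 \<le> (\<integral>x. ln (a (Suc n) x) \<partial>M)" for n
  proof (induction n)
    case 0
    have J: "0 \<le> (\<integral>y. ln (b 0 y) \<partial>N)" by (simp add: b0)
    have a1: "adm M s L U (a (Suc 0))" unfolding aS
      by (rule sch_uniform[OF b0' J]) (use L in \<open>auto simp: U_def\<close>)
    \<comment> \<open>Since \<open>k <= 1\<close>, the first update is at least 1, which starts the
      sequence of logarithmic integrals of \<open>a\<close> at a nonnegative value;
      \<open>integral_ln_mono\<close> keeps both sequences nonnegative.\<close>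
    have "1 \<le> a (Suc 0) x" for x
      using Z_le[OF b0', of x] Z_pos[OF b0', of x] by (simp add: aS sch_def b0 N.prob_space)
    then have "0 \<le> (\<integral>x. ln (a (Suc 0) x) \<partial>M)" by (intro integral_nonneg_AE) auto
    with b0' J a1 show ?case by simp
  next
    case (Suc n)
    then have b: "adm N t L U (b n)" "0 \<le> (\<integral>y. ln (b n y) \<partial>N)"
      and a: "adm M s L U (a (Suc n))" "0 \<le> (\<integral>x. ln (a (Suc n) x) \<partial>M)" by auto
    have b': "adm N t L U (b (Suc n))" unfolding bS
      by (rule D.sch_uniform[OF a]) (use L in \<open>auto simp: U_def\<close>)
    have Jb: "0 \<le> (\<integral>y. ln (b (Suc n) y) \<partial>N)"
      using integral_ln_mono[OF b(1)] b(2) by (simp add: bS aS)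
    have a': "adm M s L U (a (Suc (Suc n)))" unfolding aS
      by (rule sch_uniform[OF b' Jb]) (use L in \<open>auto simp: U_def\<close>)
    have "0 \<le> (\<integral>x. ln (a (Suc (Suc n)) x) \<partial>M)"
      using D.integral_ln_mono[OF a(1)] a(2) unfolding bS[symmetric] aS[of "Suc n"] by simp
    with b' Jb a' show ?case by simp
  qed
  have "adm M s L U (a n)" for n using a0' P by (cases n) auto
  with P show ?thesis by blast
qed

lemma sinkhorn_log_convergence:
  fixes a :: "nat \<Rightarrow> 'a \<Rightarrow> real" and b :: "nat \<Rightarrow> 'b \<Rightarrow> real"
  assumes a0: "a 0 = (\<lambda>_. 1)" and b0: "b 0 = (\<lambda>_. 1)"
    and aS: "\<And>n. a (Suc n) = sch N k (b n)" and bS: "\<And>n. b (Suc n) = sch M (\<lambda>y x. k x y) (a (Suc n))"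
    and adm: "\<And>n. adm M s l u (a n)" "\<And>n. adm N t l u (b n)"
    and G: "adm M s l u G1" "adm N t l u G2" and G1: "G1 = sch N k G2" and G2: "G2 = sch M (\<lambda>y x. k x y) G1"
  shows "\<exists>\<beta> \<kappa> \<eta>. 0 < \<beta> \<and> 0 < \<kappa> \<and> \<kappa> < 1 \<and> 0 < \<eta> \<and> (\<forall>n.
     (\<exists>q. \<forall>x. \<bar>ln (a n x) - ln (G1 x) - q\<bar> \<le> \<eta> * \<kappa> ^ n * (1 + \<beta> * s x)) \<and>
     (\<exists>q. \<forall>y. \<bar>ln (b n y) - ln (G2 y) - q\<bar> \<le> \<eta> * \<kappa> ^ n * (1 + \<beta> * t y)))"
proof -
  interpret D: bounded_kernel N M "\<lambda>y x. k x y" t s by (rule dual)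
  have u: "0 < u" and l: "0 < l" using adm_bound_pos[OF G(1)] G(1) by (auto simp: adm_def)
  \<comment> \<open>\<open>I\<close> and \<open>J\<close> bound the moments on both sides at once,
    so that both half steps share one contraction factor.\<close>
  define I where "I = max (\<integral>y. exp (3 * t y) \<partial>N) (\<integral>x. exp (3 * s x) \<partial>M)"
  define J where "J = min (\<integral>y. exp (- t y) \<partial>N) (\<integral>x. exp (- s x) \<partial>M)"
  have J: "0 < J" using discount_pos D.discount_pos by (simp add: J_def)
  have "(\<integral>y. exp (t y) \<partial>N) \<le> (\<integral>y. exp (3 * t y) \<partial>N)"
    using integrable_exp[of 1] integrable_exp[of 3] t_nonneg by (intro integral_mono) auto
  then have I: "0 < I" using exp_integral_pos by (simp add: I_def less_max_iff_disj)
  \<comment> \<open>\<open>C\<close> is the smallest nonnegative constant with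
    \<open>u * I <= exp (2 * C) * (l * J)\<close>. The 1 in \<open>R\<close> makes \<open>R\<close>
    positive, hence the last entry of \<open>\<kappa>\<close> less than one; the 1 in
    \<open>\<beta>\<close> covers \<open>C = 0\<close> while keeping
    \<open>2 * \<beta> * C <= \<alpha>\<close>.\<close>
  define C where "C = ln (max 1 (u * I / (l * J))) / 2"
  define R where "R = 8 * C + 1"
  define \<alpha> where "\<alpha> = exp (- R) * l * J / (u * I)"
  define \<beta> where "\<beta> = \<alpha> / (2 * C + 1)"
  define \<kappa> where "\<kappa> = max (3 / 4) (max (1 - \<alpha> / 2) ((2 + 3 / 4 * (\<beta> * R)) / (2 + \<beta> * R)))"
  \<comment> \<open>Large enough for the crude bound \<open>ln (u / l) + t\<close> on the initial
    error: the second entry gives \<open>\<eta> * \<beta> >= 1\<close>.\<close>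
  define \<eta> where "\<eta> = max (ln (u / l)) (1 / \<beta>)"
  have C0: "0 \<le> C" by (simp add: C_def)
  have R0: "0 < R" using C0 by (simp add: R_def)
  have \<alpha>0: "0 < \<alpha>" using u l I J by (simp add: \<alpha>_def)
  have \<beta>0: "0 < \<beta>" using \<alpha>0 C0 by (simp add: \<beta>_def)
  have \<kappa>: "1 - \<alpha> / 2 \<le> \<kappa>" "3 / 4 \<le> \<kappa>" by (auto simp: \<kappa>_def)
  have bR: "0 < \<beta> * R" using \<beta>0 R0 by simp
  have "(2 + 3 / 4 * (\<beta> * R)) / (2 + \<beta> * R) \<le> \<kappa>" by (simp add: \<kappa>_def)
  then have \<kappa>R: "2 + 3 / 4 * (\<beta> * R) \<le> \<kappa> * (2 + \<beta> * R)"
    using bR by (subst (asm) pos_divide_le_eq) auto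
  have "(2 + 3 / 4 * r) / (2 + r) < 1" if "0 < r" for r :: real using that by simp
  from this[OF bR] have \<kappa>1: "\<kappa> < 1" using \<alpha>0 by (simp add: \<kappa>_def)
  have "u * I / (l * J) \<le> exp (2 * C)" by (simp add: C_def)
  then have C: "u * I \<le> exp (2 * C) * (l * J)" using l J by (simp add: pos_divide_le_eq)
  have \<alpha>: "\<alpha> * (u * I) \<le> exp (- R) * l * J" using u I by (simp add: \<alpha>_def)
  have "\<beta> * (2 * C) \<le> \<beta> * (2 * C + 1)" using \<beta>0 by (intro mult_left_mono) auto
  also have "\<dots> = \<alpha>" using C0 by (simp add: \<beta>_def)
  finally have \<beta>: "2 * \<beta> * C \<le> \<alpha>" by (simp add: mult_ac)
  have num: "8 * C \<le> R" by (simp add: R_def)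
  have \<eta>0: "0 < \<eta>" using \<beta>0 by (simp add: \<eta>_def less_max_iff_disj)
  have start: "ln (u / l) + r \<le> \<eta> * (1 + \<beta> * r)" if "0 \<le> r" for r
  proof -
    have "1 = 1 / \<beta> * \<beta>" using \<beta>0 by simp
    also have "\<dots> \<le> \<eta> * \<beta>" using \<beta>0 by (intro mult_right_mono) (auto simp: \<eta>_def)
    finally have "1 * r \<le> \<eta> * \<beta> * r" using that by (rule mult_right_mono)
    moreover have "ln (u / l) \<le> \<eta>" by (simp add: \<eta>_def)
    ultimately show ?thesis by (simp add: algebra_simps)
  qed
  have stepN: "\<exists>q'. \<forall>x. \<bar>ln (a (Suc n) x) - ln (G1 x) - q'\<bar> \<le> \<kappa> * d * (1 + \<beta> * s x)"
    if "\<And>y. \<bar>ln (b n y) - ln (G2 y) - q\<bar> \<le> d * (1 + \<beta> * t y)" for n q d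
    unfolding aS G1
    by (rule sch_contraction[OF adm(2) G(2) that _ _ C \<alpha> _ num \<beta>0 \<beta> \<kappa> \<kappa>R])
       (use \<alpha>0 in \<open>auto simp: I_def J_def\<close>)
  have stepM: "\<exists>q'. \<forall>y. \<bar>ln (b (Suc n) y) - ln (G2 y) - q'\<bar> \<le> \<kappa> * d * (1 + \<beta> * t y)"
    if "\<And>x. \<bar>ln (a (Suc n) x) - ln (G1 x) - q\<bar> \<le> d * (1 + \<beta> * s x)" for n q d
    by (subst bS, subst G2, rule D.sch_contraction[OF adm(1) G(1) that _ _ C \<alpha> _ num \<beta>0 \<beta> \<kappa> \<kappa>R])
       (use \<alpha>0 in \<open>auto simp: I_def J_def\<close>)
  \<comment> \<open>A sweep contains two contractions, and \<open>a (Suc n)\<close> is half a sweep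
    behind \<open>b n\<close>; hence the exponents \<open>2 * n\<close> and
    \<open>2 * n + 1\<close>.\<close>
  have P: "(\<exists>q. \<forall>y. \<bar>ln (b n y) - ln (G2 y) - q\<bar> \<le> \<eta> * \<kappa> ^ (2 * n) * (1 + \<beta> * t y)) \<and>
     (\<exists>q. \<forall>x. \<bar>ln (a (Suc n) x) - ln (G1 x) - q\<bar> \<le> \<eta> * \<kappa> ^ (2 * n + 1) * (1 + \<beta> * s x))" for n
  proof (induction n)
    case 0
    have b: "\<bar>ln (b 0 y) - ln (G2 y) - 0\<bar> \<le> \<eta> * (1 + \<beta> * t y)" for y
      using log_ratio_bound[OF adm(2)[of 0] G(2) t_nonneg, of y] start[OF t_nonneg, of y] by simp
    have "\<exists>q. \<forall>y. \<bar>ln (b 0 y) - ln (G2 y) - q\<bar> \<le> \<eta> * \<kappa> ^ (2 * 0) * (1 + \<beta> * t y)"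
      using b by (intro exI[of _ 0]) simp
    with stepN[OF b] show ?case by (auto simp: mult_ac)
  next
    case (Suc n)
    then obtain q where "\<And>x. \<bar>ln (a (Suc n) x) - ln (G1 x) - q\<bar> \<le> \<eta> * \<kappa> ^ (2 * n + 1) * (1 + \<beta> * s x)" by blast
    from stepM[OF this] obtain q' where
      b: "\<And>y. \<bar>ln (b (Suc n) y) - ln (G2 y) - q'\<bar> \<le> \<kappa> * (\<eta> * \<kappa> ^ (2 * n + 1)) * (1 + \<beta> * t y)" by blast
    from stepN[OF b] b show ?case by (auto simp: mult_ac)
  qed
  have ek: "\<eta> \<le> \<eta> / \<kappa>" using \<kappa>1 \<kappa>(2) \<eta>0 by (simp add: pos_le_divide_eq)
  have sq: "(\<kappa>\<^sup>2) ^ n = \<kappa> ^ (2 * n)" for n by (simp add: power_mult)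
  \<comment> \<open>The rate per sweep is the square of \<open>\<kappa>\<close>. Dividing
    \<open>\<eta>\<close> by \<open>\<kappa>\<close> absorbs the odd exponent of
    \<open>a (Suc m)\<close>; \<open>a 0\<close> does not come from a half step and is bounded
    directly.\<close>
  show ?thesis
  proof (rule exI[of _ \<beta>], rule exI[of _ "\<kappa>\<^sup>2"], rule exI[of _ "\<eta> / \<kappa>"], intro conjI allI)
    show "0 < \<beta>" by (rule \<beta>0)
    show "0 < \<kappa>\<^sup>2" "0 < \<eta> / \<kappa>" using \<kappa>(2) \<eta>0 by auto
    show "\<kappa>\<^sup>2 < 1" using \<kappa>1 \<kappa>(2) by (simp add: power_less_one_iff)
    fix n
    obtain q where q: "\<And>y. \<bar>ln (b n y) - ln (G2 y) - q\<bar> \<le> \<eta> * \<kappa> ^ (2 * n) * (1 + \<beta> * t y)" using P by blast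
    have "\<bar>ln (b n y) - ln (G2 y) - q\<bar> \<le> \<eta> / \<kappa> * (\<kappa>\<^sup>2) ^ n * (1 + \<beta> * t y)" for y
      using \<beta>0 \<kappa>(2) t_nonneg[of y] unfolding sq
      by (intro order_trans[OF q] mult_right_mono ek) auto
    then show "\<exists>q. \<forall>y. \<bar>ln (b n y) - ln (G2 y) - q\<bar> \<le> \<eta> / \<kappa> * (\<kappa>\<^sup>2) ^ n * (1 + \<beta> * t y)" by blast
    show "\<exists>q. \<forall>x. \<bar>ln (a n x) - ln (G1 x) - q\<bar> \<le> \<eta> / \<kappa> * (\<kappa>\<^sup>2) ^ n * (1 + \<beta> * s x)"
    proof (cases n)
      case 0
      have "\<bar>ln (a 0 x) - ln (G1 x) - 0\<bar> \<le> \<eta> / \<kappa> * (1 + \<beta> * s x)" for x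
      proof -
        have "\<bar>ln (a 0 x) - ln (G1 x) - 0\<bar> \<le> \<eta> * (1 + \<beta> * s x)"
          using log_ratio_bound[OF adm(1)[of 0] G(1) s_nonneg, of x] start[OF s_nonneg, of x] by simp
        also have "\<dots> \<le> \<eta> / \<kappa> * (1 + \<beta> * s x)"
          using ek \<beta>0 s_nonneg[of x] by (intro mult_right_mono) auto
        finally show ?thesis .
      qed
      then show ?thesis using 0 by (intro exI[of _ 0]) simp
    next
      case (Suc m)
      have "\<eta> / \<kappa> * (\<kappa>\<^sup>2) ^ n = \<eta> * \<kappa> ^ (2 * m + 1)"
        using \<kappa>(2) unfolding sq Suc by simp
      then show ?thesis using P[of m] Suc by simp
    qed
  qed
qed

text \<open>Mean value estimate for exp. One factor \<open>exp (t y)\<close> is the size of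
  \<open>a\<close> and \<open>G\<close>, the other dominates \<open>1 + \<beta> * t y\<close>.
  Comparison at the single point \<open>y0\<close> bounds \<open>q\<close>, independently of
  \<open>d\<close>.\<close>

lemma log_to_difference:
  assumes a: "adm N t l u a" and G: "adm N t l u G" and B: "0 < \<beta>" "0 \<le> d" "d \<le> D"
    and q: "\<And>y. \<bar>ln (a y) - ln (G y) - q\<bar> \<le> d * (1 + \<beta> * t y)"
    and Q: "ln (u / l) + t y0 + D * (1 + \<beta> * t y0) \<le> Q"
  shows "\<bar>q\<bar> \<le> Q" "\<bar>a y - exp q * G y\<bar> \<le> u * exp Q * (1 + \<beta>) * d * exp (2 * t y)"
proof -
  have "d * (1 + \<beta> * t y0) \<le> D * (1 + \<beta> * t y0)" using B t_nonneg[of y0] by (intro mult_right_mono) auto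
  then show qQ: "\<bar>q\<bar> \<le> Q"
    using q[of y0] log_ratio_bound[OF a G t_nonneg, of y0] Q by linarith
  have u: "0 < u" using adm_bound_pos[OF a] .
  have Q0: "0 \<le> Q" using qQ by linarith
  have ea: "exp (ln (a y)) = a y" and eG: "exp (ln (G y) + q) = exp q * G y"
    using adm_pos[OF a, of y] adm_pos[OF G, of y] by (auto simp: exp_add)
  have m: "a y \<le> u * exp Q * exp (t y)"
  proof -
    have "a y \<le> 1 * (u * exp (t y))" using a by (simp add: adm_def)
    also have "\<dots> \<le> exp Q * (u * exp (t y))" using Q0 u by (intro mult_right_mono) auto
    finally show ?thesis by (simp add: mult_ac)
  qed
  have m': "exp q * G y \<le> u * exp Q * exp (t y)"
  proof -
    have "exp q * G y \<le> exp Q * (u * exp (t y))"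
      using G qQ adm_pos[OF G, of y] by (intro mult_mono) (auto simp: adm_def)
    then show ?thesis by (simp add: mult_ac)
  qed
  have "\<bar>a y - exp q * G y\<bar> \<le> u * exp Q * exp (t y) * \<bar>ln (a y) - (ln (G y) + q)\<bar>"
    using abs_exp_diff_le[of "ln (a y)" "u * exp Q * exp (t y)" "ln (G y) + q"] m m' by (simp add: ea eG)
  also have "\<dots> \<le> u * exp Q * exp (t y) * (d * ((1 + \<beta>) * exp (t y)))"
  proof (intro mult_left_mono)
    have "d * (1 + \<beta> * t y) \<le> d * ((1 + \<beta>) * exp (t y))"
      using affine_le_exp[of 1 \<beta> "t y"] B t_nonneg by (intro mult_left_mono) auto
    then show "\<bar>ln (a y) - (ln (G y) + q)\<bar> \<le> d * ((1 + \<beta>) * exp (t y))"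
      using q[of y] by (simp add: algebra_simps)
  qed (use u in auto)
  also have "\<dots> = u * exp Q * (1 + \<beta>) * d * (exp (t y) * exp (t y))" by (simp add: mult_ac)
  also have "exp (t y) * exp (t y) = exp (2 * t y)" by (simp add: exp_add[symmetric])
  finally show "\<bar>a y - exp q * G y\<bar> \<le> u * exp Q * (1 + \<beta>) * d * exp (2 * t y)" .
qed

theorem sinkhorn_convergence:
  fixes a :: "nat \<Rightarrow> 'a \<Rightarrow> real" and b :: "nat \<Rightarrow> 'b \<Rightarrow> real"
  assumes a0: "a 0 = (\<lambda>_. 1)" and b0: "b 0 = (\<lambda>_. 1)"
    and aS: "\<And>n. a (Suc n) = sch N k (b n)" and bS: "\<And>n. b (Suc n) = sch M (\<lambda>y x. k x y) (a (Suc n))"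
    and G: "adm M s l1 u1 G1" "adm N t l2 u2 G2" and G1: "G1 = sch N k G2" and G2: "G2 = sch M (\<lambda>y x. k x y) G1"
  obtains l u B Q \<kappa> where "0 < \<kappa>" "\<kappa> < 1" "0 < B"
    "\<And>n. adm M s l u (a n)" "\<And>n. adm N t l u (b n)" "adm M s l u G1" "adm N t l u G2"
    "\<And>n. \<exists>q. \<bar>q\<bar> \<le> Q \<and> (\<forall>x. \<bar>a n x - exp q * G1 x\<bar> \<le> B * \<kappa> ^ n * exp (2 * s x))"
    "\<And>n. \<exists>q. \<bar>q\<bar> \<le> Q \<and> (\<forall>y. \<bar>b n y - exp q * G2 y\<bar> \<le> B * \<kappa> ^ n * exp (2 * t y))"
proof -
  interpret D: bounded_kernel N M "\<lambda>y x. k x y" t s by (rule dual)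
  obtain l0 u0 where ab: "\<And>n. adm M s l0 u0 (a n)" "\<And>n. adm N t l0 u0 (b n)"
    using sinkhorn_bounds[OF a0 b0 aS bS] by blast
  define l where "l = min l0 (min l1 l2)"
  define u where "u = max u0 (max u1 u2)"
  have l: "0 < l" using ab(1)[of 0] G by (simp add: l_def adm_def)
  have adm: "\<And>n. adm M s l u (a n)" "\<And>n. adm N t l u (b n)" "adm M s l u G1" "adm N t l u G2"
    by (rule adm_mono[OF ab(1) l] adm_mono[OF ab(2) l] adm_mono[OF G(1) l] adm_mono[OF G(2) l];
         simp add: l_def u_def)+
  have u: "0 < u" using adm_bound_pos[OF adm(3)] .
  obtain \<beta> \<kappa> \<eta> where c: "0 < \<beta>" "0 < \<kappa>" "\<kappa> < 1" "0 < \<eta>"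
     and A: "\<And>n. \<exists>q. \<forall>x. \<bar>ln (a n x) - ln (G1 x) - q\<bar> \<le> \<eta> * \<kappa> ^ n * (1 + \<beta> * s x)"
     "\<And>n. \<exists>q. \<forall>y. \<bar>ln (b n y) - ln (G2 y) - q\<bar> \<le> \<eta> * \<kappa> ^ n * (1 + \<beta> * t y)"
    using sinkhorn_log_convergence[OF a0 b0 aS bS adm G1 G2] by blast
  \<comment> \<open>\<open>undefined\<close> is merely some point at which the scalars q are
    estimated.\<close>
  define Q where "Q = max (ln (u / l) + s undefined + \<eta> * (1 + \<beta> * s undefined))
      (ln (u / l) + t undefined + \<eta> * (1 + \<beta> * t undefined))"
  have d: "0 \<le> \<eta> * \<kappa> ^ n" "\<eta> * \<kappa> ^ n \<le> \<eta>" for n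
    using c by (auto simp: power_le_one mult_left_le)
  define B where "B = u * exp Q * (1 + \<beta>) * \<eta>"
  have Beq: "u * exp Q * (1 + \<beta>) * (\<eta> * \<kappa> ^ n) = B * \<kappa> ^ n" for n by (simp add: B_def)
  have Q': "ln (u / l) + s undefined + \<eta> * (1 + \<beta> * s undefined) \<le> Q"
    "ln (u / l) + t undefined + \<eta> * (1 + \<beta> * t undefined) \<le> Q" by (auto simp: Q_def)
  have "0 < B" using u c by (simp add: B_def)
  moreover have "\<exists>q. \<bar>q\<bar> \<le> Q \<and> (\<forall>x. \<bar>a n x - exp q * G1 x\<bar> \<le> B * \<kappa> ^ n * exp (2 * s x))" for n
  proof -
    obtain q where q: "\<And>x. \<bar>ln (a n x) - ln (G1 x) - q\<bar> \<le> \<eta> * \<kappa> ^ n * (1 + \<beta> * s x)" using A(1) by blast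
    show ?thesis
      using D.log_to_difference[OF adm(1) adm(3) c(1) d q Q'(1)] unfolding Beq by blast
  qed
  moreover have "\<exists>q. \<bar>q\<bar> \<le> Q \<and> (\<forall>y. \<bar>b n y - exp q * G2 y\<bar> \<le> B * \<kappa> ^ n * exp (2 * t y))" for n
  proof -
    obtain q where q: "\<And>y. \<bar>ln (b n y) - ln (G2 y) - q\<bar> \<le> \<eta> * \<kappa> ^ n * (1 + \<beta> * t y)" using A(2) by blast
    show ?thesis
      using log_to_difference[OF adm(2) adm(4) c(1) d q Q'(2)] unfolding Beq by blast
  qed
  ultimately show ?thesis using that c adm by blast
qed

end

section \<open>The Schroedinger system and total variation\<close>

context bounded_kernel begin

lemma kint_measurable [measurable (raw)]:
  assumes [measurable]: "g \<in> borel_measurable N" shows "kint N k g \<in> borel_measurable M"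
  unfolding kint_def by measurable

text \<open>Integrability is not assumed but forced: if the integral diverged, \<open>sch\<close>
  would take the default value 0, against \<open>g1 > 0\<close>. One point where the equation holds
  gives the discounted integral of \<open>g2\<close>, and this bounds \<open>g1\<close> almost
  everywhere by a multiple of \<open>exp s\<close>.\<close>

lemma schroedinger_integrable:
  assumes g: "g2 \<in> borel_measurable N" "\<And>y. 0 < g2 y" "g1 \<in> borel_measurable M" "\<And>x. 0 < g1 x"
    and eq: "AE x in M. g1 x = sch N k g2 x"
  shows "integrable N (\<lambda>y. exp (- t y) * g2 y)" "0 < (\<integral>y. exp (- t y) * g2 y \<partial>N)" "integrable M g1"
proof -
  interpret D: bounded_kernel N M "\<lambda>y x. k x y" t s by (rule dual)
  note [measurable] = g(1) g(3)
  have kint: "integrable N (\<lambda>y. k x y * g2 y)" if "g1 x = sch N k g2 x" for x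
  proof (rule ccontr)
    assume "\<not> integrable N (\<lambda>y. k x y * g2 y)"
    then have "g1 x = 0" unfolding that sch_def kint_def by (simp add: not_integrable_integral_eq)
    then show False using g(4)[of x] by simp
  qed
  have "\<exists>x. g1 x = sch N k g2 x"
  proof (rule ccontr)
    assume "\<not> ?thesis"
    then have "AE x in M. False" using eq by auto
    then show False by simp
  qed
  then obtain x0 where x0: "g1 x0 = sch N k g2 x0" by blast
  have le: "exp (- s x) * (exp (- t y) * g2 y) \<le> k x y * g2 y" for x y
    using mult_right_mono[OF k_ge[of x y], of "g2 y"] g(2)[of y]
    by (simp add: exp_diff exp_minus divide_inverse mult_ac)
  have "integrable N (\<lambda>y. exp (- s x0) * (exp (- t y) * g2 y))"
    by (rule Bochner_Integration.integrable_bound[OF kint[OF x0]])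
       (use le[of x0] g(2) k_pos in \<open>auto intro!: AE_I2 simp: abs_mult less_imp_le\<close>)
  then show i: "integrable N (\<lambda>y. exp (- t y) * g2 y)" by simp
  have nn: "0 \<le> (\<integral>y. exp (- t y) * g2 y \<partial>N)"
    using g(2) by (intro integral_nonneg_AE) (auto simp: less_imp_le)
  moreover have "(\<integral>y. exp (- t y) * g2 y \<partial>N) \<noteq> 0"
  proof
    assume "(\<integral>y. exp (- t y) * g2 y \<partial>N) = 0"
    then have "AE y in N. exp (- t y) * g2 y = 0"
      by (subst (asm) integral_nonneg_eq_0_iff_AE[OF i]) (use g(2) in \<open>auto simp: less_imp_le\<close>)
    then have "AE y in N. False" using g(2) by (auto simp: less_le)
    then show False by simp
  qed
  ultimately show p: "0 < (\<integral>y. exp (- t y) * g2 y \<partial>N)" by linarith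
  have "AE x in M. norm (g1 x) \<le> norm (1 / (\<integral>y. exp (- t y) * g2 y \<partial>N) * exp (s x))"
    using eq
  proof eventually_elim
    case (elim x)
    have "exp (- s x) * (\<integral>y. exp (- t y) * g2 y \<partial>N) = (\<integral>y. exp (- s x) * (exp (- t y) * g2 y) \<partial>N)" by simp
    also have "\<dots> \<le> Z g2 x" unfolding kint_def using le i kint[OF elim] by (intro integral_mono) auto
    finally have "exp (- s x) * (\<integral>y. exp (- t y) * g2 y \<partial>N) \<le> Z g2 x" .
    moreover have "0 < exp (- s x) * (\<integral>y. exp (- t y) * g2 y \<partial>N)" using p by simp
    ultimately have "1 / Z g2 x \<le> 1 / (exp (- s x) * (\<integral>y. exp (- t y) * g2 y \<partial>N))"
      by (intro divide_left_mono mult_pos_pos) (auto intro: p less_le_trans)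
    also have "\<dots> = 1 / (\<integral>y. exp (- t y) * g2 y \<partial>N) * exp (s x)" by (simp add: exp_minus field_simps)
    finally have "g1 x \<le> 1 / (\<integral>y. exp (- t y) * g2 y \<partial>N) * exp (s x)" using elim by (simp add: sch_def)
    then show ?case using g(4)[of x] by (simp only: real_norm_def abs_of_pos)
  qed
  then show "integrable M g1"
    by (rule Bochner_Integration.integrable_bound[rotated 2])
       (use D.integrable_exp[of 1] in auto)
qed

text \<open>Replaces a potential that solves its equation almost everywhere by a version with bounds
  at every point.\<close>

lemma schroedinger_adm:
  assumes g: "g2 \<in> borel_measurable N" "\<And>y. 0 < g2 y" "integrable N g2"
    and i: "integrable N (\<lambda>y. exp (- t y) * g2 y)" and p: "0 < (\<integral>y. exp (- t y) * g2 y \<partial>N)"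
  shows "\<exists>l u. adm M s l u (sch N k g2)"
proof -
  let ?d = "\<integral>y. exp (- t y) * g2 y \<partial>N"
  note [measurable] = g(1)
  have kg: "k x y * g2 y \<le> g2 y" for x y
    using mult_right_mono[OF k_le_1[of x y], of "g2 y"] g(2)[of y] by simp
  have ki: "integrable N (\<lambda>y. k x y * g2 y)" for x
    by (rule Bochner_Integration.integrable_bound[OF g(3)])
       (use kg k_pos g(2) in \<open>auto intro!: AE_I2 simp: abs_mult less_imp_le\<close>)
  have le: "exp (- s x) * (exp (- t y) * g2 y) \<le> k x y * g2 y" for x y
    using mult_right_mono[OF k_ge[of x y], of "g2 y"] g(2)[of y]
    by (simp add: exp_diff exp_minus divide_inverse mult_ac)
  have lo: "exp (- s x) * ?d \<le> Z g2 x" for x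
  proof -
    have "exp (- s x) * ?d = (\<integral>y. exp (- s x) * (exp (- t y) * g2 y) \<partial>N)" by simp
    also have "\<dots> \<le> Z g2 x" unfolding kint_def using le i ki by (intro integral_mono) auto
    finally show ?thesis .
  qed
  have up: "Z g2 x \<le> (\<integral>y. g2 y \<partial>N)" for x
    unfolding kint_def using kg ki g(3) by (intro integral_mono) auto
  have Zp: "0 < Z g2 x" for x
    by (rule less_le_trans[OF _ lo]) (use p in simp)
  have Ip: "0 < (\<integral>y. g2 y \<partial>N)" using Zp[of undefined] up[of undefined] by linarith
  have "adm M s (1 / (\<integral>y. g2 y \<partial>N)) (1 / ?d) (sch N k g2)"
    unfolding adm_def
  proof (intro conjI allI)
    show "sch N k g2 \<in> borel_measurable M" unfolding sch_def[abs_def] by measurable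
    show "0 < 1 / (\<integral>y. g2 y \<partial>N)" using Ip by simp
    fix x
    show "1 / (\<integral>y. g2 y \<partial>N) \<le> sch N k g2 x"
      unfolding sch_def using Zp[of x] up[of x] Ip by (intro divide_left_mono) auto
    have "1 / Z g2 x \<le> 1 / (exp (- s x) * ?d)"
      using lo[of x] p Zp[of x] by (intro divide_left_mono) auto
    then show "sch N k g2 x \<le> 1 / ?d * exp (s x)" by (simp add: sch_def exp_minus field_simps)
  qed
  then show ?thesis by blast
qed

section \<open>L1 distance of the coupling densities\<close>

lemma pair_integrand_nonneg:
  assumes "adm N t l u a" "adm M s l' u' b"
  shows "0 \<le> (case z of (x, y) \<Rightarrow> k x y * b x * a y)"
  using adm_pos[OF assms(1)] adm_pos[OF assms(2)] k_pos by (auto split: prod.split simp: less_imp_le)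

text \<open>The first density is L1-close to \<open>\<theta>\<close> times the second, with
  \<open>\<theta> = exp (q + q')\<close>. Integrating this difference bounds
  \<open>\<bar>1 - \<theta>\<bar>\<close> by the same error, hence the factor 2.\<close>

lemma pair_L1_bound:
  assumes a: "adm M s l u a" and b: "adm N t l u b" and G1: "adm M s l u G1" and G2: "adm N t l u G2"
    and q: "\<bar>q\<bar> \<le> Q" "\<And>x. \<bar>a x - exp q * G1 x\<bar> \<le> d * exp (2 * s x)"
      "\<bar>q'\<bar> \<le> Q" "\<And>y. \<bar>b y - exp q' * G2 y\<bar> \<le> d * exp (2 * t y)" and d: "0 \<le> d"
    and m: "(\<integral>(x,y). k x y * a x * b y \<partial>(M \<Otimes>\<^sub>M N)) = 1" "(\<integral>(x,y). k x y * G1 x * G2 y \<partial>(M \<Otimes>\<^sub>M N)) = 1"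
  shows "(\<integral>(x,y). \<bar>k x y * a x * b y - k x y * G1 x * G2 y\<bar> \<partial>(M \<Otimes>\<^sub>M N))
     \<le> 2 * (d * u * (1 + exp Q) * (\<integral>x. exp (2 * s x) \<partial>M) * (\<integral>y. exp (2 * t y) \<partial>N))"
proof -
  interpret D: bounded_kernel N M "\<lambda>y x. k x y" t s by (rule dual)
  interpret P: pair_sigma_finite M N ..
  define c where "c = d * u * (1 + exp Q)"
  define \<theta> where "\<theta> = exp (q + q')"
  let ?f = "\<lambda>(x,y). k x y * a x * b y" and ?g = "\<lambda>(x,y). k x y * G1 x * G2 y"
  let ?e = "\<lambda>(x,y). exp (2 * s x) * exp (2 * t y)"
  have fi: "integrable (M \<Otimes>\<^sub>M N) ?f" and gi: "integrable (M \<Otimes>\<^sub>M N) ?g"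
    using pair_integrable[OF b a] pair_integrable[OF G2 G1] by auto
  have ei: "integrable (M \<Otimes>\<^sub>M N) ?e"
  proof (rule P.Fubini_integrable)
    show "integrable M (\<lambda>x. \<integral>y. norm (case (x, y) of (x, y) \<Rightarrow> exp (2 * s x) * exp (2 * t y)) \<partial>N)"
      using D.integrable_exp[of 2] by (simp add: abs_mult)
    show "AE x in M. integrable N (\<lambda>y. case (x, y) of (x, y) \<Rightarrow> exp (2 * s x) * exp (2 * t y))"
      using integrable_exp[of 2] by simp
  qed measurable
  have eI: "(\<integral>z. ?e z \<partial>(M \<Otimes>\<^sub>M N)) = (\<integral>x. exp (2 * s x) \<partial>M) * (\<integral>y. exp (2 * t y) \<partial>N)"
    using P.integral_fst'[OF ei] by simp
  have u: "0 < u" using adm_bound_pos[OF a] .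
  have pw: "\<bar>?f z - \<theta> * ?g z\<bar> \<le> c * ?e z" for z
  proof (cases z)
    case (Pair x y)
    have "\<bar>?f z - \<theta> * ?g z\<bar> = k x y * \<bar>a x * b y - (exp q * G1 x) * (exp q' * G2 y)\<bar>"
    proof -
      have "?f z - \<theta> * ?g z = k x y * (a x * b y - (exp q * G1 x) * (exp q' * G2 y))"
        by (simp add: Pair \<theta>_def exp_add algebra_simps)
      then show ?thesis using k_pos[of x y] by (simp only: abs_mult abs_of_pos)
    qed
    also have "\<dots> \<le> 1 * \<bar>a x * b y - (exp q * G1 x) * (exp q' * G2 y)\<bar>"
      by (intro mult_right_mono k_le_1) auto
    also have "a x * b y - (exp q * G1 x) * (exp q' * G2 y)
        = (a x - exp q * G1 x) * b y + exp q * G1 x * (b y - exp q' * G2 y)" by (simp add: algebra_simps)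
    also have "1 * \<bar>\<dots>\<bar> \<le> \<bar>a x - exp q * G1 x\<bar> * \<bar>b y\<bar> + \<bar>exp q * G1 x\<bar> * \<bar>b y - exp q' * G2 y\<bar>"
      by (simp add: abs_mult[symmetric])
    also have "\<dots> \<le> (d * exp (2 * s x)) * (u * exp (2 * t y)) + (exp Q * (u * exp (2 * s x))) * (d * exp (2 * t y))"
    proof (intro add_mono mult_mono q)
      show "\<bar>b y\<bar> \<le> u * exp (2 * t y)"
        using adm_abs_le[OF b, of y] t_nonneg[of y] u by (smt (verit) exp_le_cancel_iff mult_left_mono)
      have "\<bar>G1 x\<bar> \<le> u * exp (2 * s x)"
        using D.adm_abs_le[OF G1, of x] s_nonneg[of x] u by (smt (verit) exp_le_cancel_iff mult_left_mono)
      then show "\<bar>exp q * G1 x\<bar> \<le> exp Q * (u * exp (2 * s x))"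
        using q(1) by (simp add: abs_mult) (intro mult_mono, auto)
    qed (use u d in auto)
    also have "\<dots> = c * ?e z" by (simp add: Pair c_def algebra_simps)
    finally show ?thesis .
  qed
  have di: "integrable (M \<Otimes>\<^sub>M N) (\<lambda>z. ?f z - \<theta> * ?g z)" using fi gi by auto
  have L1: "(\<integral>z. \<bar>?f z - \<theta> * ?g z\<bar> \<partial>(M \<Otimes>\<^sub>M N)) \<le> c * (\<integral>z. ?e z \<partial>(M \<Otimes>\<^sub>M N))"
    unfolding integral_mult_right_zero[symmetric] using pw ei di by (intro integral_mono) auto
  have "1 - \<theta> = (\<integral>z. ?f z - \<theta> * ?g z \<partial>(M \<Otimes>\<^sub>M N))" using fi gi m by simp
  then have th: "\<bar>1 - \<theta>\<bar> \<le> (\<integral>z. \<bar>?f z - \<theta> * ?g z\<bar> \<partial>(M \<Otimes>\<^sub>M N))" by simp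
  have "(\<integral>z. \<bar>?f z - ?g z\<bar> \<partial>(M \<Otimes>\<^sub>M N)) \<le> (\<integral>z. \<bar>?f z - \<theta> * ?g z\<bar> + \<bar>1 - \<theta>\<bar> * ?g z \<partial>(M \<Otimes>\<^sub>M N))"
  proof (rule integral_mono)
    fix z
    have "0 \<le> ?g z" using pair_integrand_nonneg[OF G2 G1] .
    then have "\<bar>\<theta> * ?g z - ?g z\<bar> = \<bar>1 - \<theta>\<bar> * ?g z"
    proof -
      have "\<theta> * ?g z - ?g z = (\<theta> - 1) * ?g z" by (simp only: left_diff_distrib mult_1)
      then show ?thesis using \<open>0 \<le> ?g z\<close> by (simp only: abs_mult abs_of_nonneg abs_minus_commute)
    qed
    then show "\<bar>?f z - ?g z\<bar> \<le> \<bar>?f z - \<theta> * ?g z\<bar> + \<bar>1 - \<theta>\<bar> * ?g z" by linarith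
  qed (use fi gi integrable_abs[OF di] integrable_abs[OF Bochner_Integration.integrable_diff[OF fi gi]] in auto)
  also have "\<dots> = (\<integral>z. \<bar>?f z - \<theta> * ?g z\<bar> \<partial>(M \<Otimes>\<^sub>M N)) + \<bar>1 - \<theta>\<bar>"
    using di gi m by (subst Bochner_Integration.integral_add) auto
  also have "\<dots> \<le> 2 * (c * (\<integral>z. ?e z \<partial>(M \<Otimes>\<^sub>M N)))" using th L1 by linarith
  finally have "(\<integral>z. \<bar>?f z - ?g z\<bar> \<partial>(M \<Otimes>\<^sub>M N)) \<le> 2 * (c * (\<integral>z. ?e z \<partial>(M \<Otimes>\<^sub>M N)))" .
  then show ?thesis unfolding eI c_def by (simp add: case_prod_beta' mult.assoc)
qed

end

text \<open>Meant for the initial density, whose mass is at most one but need not be one.\<close>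

lemma integral_abs_diff_le_two:
  fixes f g :: "'a \<Rightarrow> real"
  assumes f: "integrable M f" "\<And>z. 0 \<le> f z" "(\<integral>z. f z \<partial>M) \<le> 1"
    and g: "integrable M g" "\<And>z. 0 \<le> g z" "(\<integral>z. g z \<partial>M) \<le> 1"
  shows "(\<integral>z. \<bar>f z - g z\<bar> \<partial>M) \<le> 2"
proof -
  have "(\<integral>z. \<bar>f z - g z\<bar> \<partial>M) \<le> (\<integral>z. f z + g z \<partial>M)"
    using f g by (intro integral_mono) (auto simp: abs_le_iff add_increasing add_increasing2)
  then show ?thesis using f g by simp
qed

section \<open>Tails and the cones\<close>

lemma borel_measurable_dist_centre:
  fixes x0 :: "'a::metric_space" and \<phi> :: "real \<Rightarrow> real"
  assumes "sets \<rho> = sets borel" "\<phi> \<in> borel_measurable borel"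
  shows "(\<lambda>x. \<phi> (dist x0 x)) \<in> borel_measurable \<rho>"
proof -
  have "(\<lambda>x. dist x0 x) \<in> borel_measurable \<rho>"
    unfolding measurable_cong_sets[OF assms(1) refl]
    by (intro borel_measurable_continuous_onI continuous_intros)
  from measurable_compose[OF this assms(2)] show ?thesis .
qed

text \<open>A point at distance d > m lies in one unit shell, m + j < d <= m + j + 1, and
  \<open>\<phi>\<close> is bounded by its value at the outer radius. The shells are enlarged to
  complements of balls, for which tail bounds are available.\<close>

lemma step_sum_ge:
  fixes \<phi> :: "real \<Rightarrow> real" and m :: nat
  assumes mono: "\<And>r r'. 0 \<le> r \<Longrightarrow> r \<le> r' \<Longrightarrow> \<phi> r \<le> \<phi> r'" and nn: "0 \<le> \<phi> 0" and d: "0 \<le> d"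
  shows "ennreal (\<phi> d) \<le> ennreal (\<phi> m) + (\<Sum>j. ennreal (\<phi> (real (m + j) + 1)) * indicator {r. real (m + j) < r} d)"
proof (cases "d \<le> real m")
  case True
  then show ?thesis using mono[OF d True] by (auto intro!: add_increasing2 ennreal_leI)
next
  case False
  define j where "j = nat \<lceil>d\<rceil> - 1 - m"
  have "m < nat \<lceil>d\<rceil>" using False by linarith
  then have mj: "m + j = nat \<lceil>d\<rceil> - 1" "0 < nat \<lceil>d\<rceil>" unfolding j_def by linarith+
  have "real (m + j) < d" "d \<le> real (m + j) + 1" using mj d by linarith+
  then have "ennreal (\<phi> d) \<le> ennreal (\<phi> (real (m + j) + 1)) * indicator {r. real (m + j) < r} d"
    using mono[OF d, of "real (m + j) + 1"] by (auto intro!: ennreal_leI)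
  also have "\<dots> \<le> (\<Sum>j. ennreal (\<phi> (real (m + j) + 1)) * indicator {r. real (m + j) < r} d)"
  proof -
    define v where "v j = ennreal (\<phi> (real (m + j) + 1)) * indicator {r. real (m + j) < r} d" for j
    have "v j \<le> suminf v" using sum_le_suminf[of v "{j}"] by simp
    then show ?thesis by (simp only: v_def[abs_def])
  qed
  finally show ?thesis by (simp add: add_increasing)
qed

text \<open>Used with F = 1 to obtain exponential moments of the marginals, and with F an element of
  the first cone to bound its weighted integral.\<close>

lemma nn_integral_radial_le:
  fixes x0 :: "'a::metric_space" and F :: "'a \<Rightarrow> ennreal" and \<phi> :: "real \<Rightarrow> real" and m :: nat
  assumes sets [measurable_cong]: "sets \<rho> = sets borel" and F [measurable]: "F \<in> borel_measurable \<rho>"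
    and mono: "\<And>r r'. 0 \<le> r \<Longrightarrow> r \<le> r' \<Longrightarrow> \<phi> r \<le> \<phi> r'" and nn: "0 \<le> \<phi> 0"
  shows "(\<integral>\<^sup>+x. F x * ennreal (\<phi> (dist x0 x)) \<partial>\<rho>)
    \<le> ennreal (\<phi> m) * (\<integral>\<^sup>+x. F x \<partial>\<rho>) +
      (\<Sum>j. ennreal (\<phi> (real (m + j) + 1)) * (\<integral>\<^sup>+x. F x * indicator (- cball x0 (real (m + j))) x \<partial>\<rho>))"
proof -
  have "(\<integral>\<^sup>+x. F x * ennreal (\<phi> (dist x0 x)) \<partial>\<rho>) \<le> (\<integral>\<^sup>+x. ennreal (\<phi> m) * F x +
      (\<Sum>j. ennreal (\<phi> (real (m + j) + 1)) * (F x * indicator (- cball x0 (real (m + j))) x)) \<partial>\<rho>)"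
  proof (rule nn_integral_mono)
    fix x
    have "F x * ennreal (\<phi> (dist x0 x)) \<le> F x * (ennreal (\<phi> m) +
      (\<Sum>j. ennreal (\<phi> (real (m + j) + 1)) * indicator {r. real (m + j) < r} (dist x0 x)))"
      by (intro mult_left_mono step_sum_ge mono nn) auto
    also have "\<dots> = ennreal (\<phi> m) * F x +
      (\<Sum>j. ennreal (\<phi> (real (m + j) + 1)) * (F x * indicator (- cball x0 (real (m + j))) x))"
      unfolding distrib_left ennreal_suminf_cmult[symmetric]
      by (intro arg_cong2[where f = "(+)"] suminf_cong) (auto simp: mult_ac indicator_def)
    finally show "F x * ennreal (\<phi> (dist x0 x)) \<le> \<dots>" .
  qed
  also have "\<dots> = ennreal (\<phi> m) * (\<integral>\<^sup>+x. F x \<partial>\<rho>) +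
      (\<Sum>j. ennreal (\<phi> (real (m + j) + 1)) * (\<integral>\<^sup>+x. F x * indicator (- cball x0 (real (m + j))) x \<partial>\<rho>))"
    by (subst nn_integral_add) (auto simp: nn_integral_cmult nn_integral_suminf)
  finally show ?thesis .
qed

lemma integrable_radial:
  fixes x0 :: "'a::metric_space" and \<phi> :: "real \<Rightarrow> real"
  assumes "prob_space \<rho>" and sets [measurable_cong]: "sets \<rho> = sets borel"
    and mono: "\<And>r r'. 0 \<le> r \<Longrightarrow> r \<le> r' \<Longrightarrow> \<phi> r \<le> \<phi> r'" and nn: "0 \<le> \<phi> 0"
    and "\<phi> \<in> borel_measurable borel"
    and tail: "\<And>r. real m \<le> r \<Longrightarrow> measure \<rho> (- cball x0 r) \<le> \<tau> r"
    and sm: "summable (\<lambda>j. \<phi> (real j + 1) * \<tau> (real j))"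
  shows "integrable \<rho> (\<lambda>x. \<phi> (dist x0 x))"
proof -
  interpret prob_space \<rho> by fact
  have pos: "0 \<le> \<phi> r" if "0 \<le> r" for r using mono[of 0 r] nn that by simp
  have \<tau>: "0 \<le> \<tau> (real (m + j))" for j using tail[of "real (m + j)"] measure_nonneg[of \<rho>]
    by (smt (verit) of_nat_0_le_iff of_nat_add)
  have "(\<integral>\<^sup>+x. ennreal (\<phi> (dist x0 x)) \<partial>\<rho>) = (\<integral>\<^sup>+x. 1 * ennreal (\<phi> (dist x0 x)) \<partial>\<rho>)" by simp
  also have "\<dots> \<le> ennreal (\<phi> m) * (\<integral>\<^sup>+x. 1 \<partial>\<rho>) +
      (\<Sum>j. ennreal (\<phi> (real (m + j) + 1)) * (\<integral>\<^sup>+x. 1 * indicator (- cball x0 (real (m + j))) x \<partial>\<rho>))"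
    by (rule nn_integral_radial_le[where \<phi> = \<phi>, OF sets _ _ nn]) (auto intro: mono)
  also have "\<dots> \<le> ennreal (\<phi> m) + (\<Sum>j. ennreal (\<phi> (real (m + j) + 1) * \<tau> (real (m + j))))"
  proof (intro add_mono suminf_le)
    fix j
    have "(\<integral>\<^sup>+x. 1 * indicator (- cball x0 (real (m + j))) x \<partial>\<rho>) = ennreal (measure \<rho> (- cball x0 (real (m + j))))"
      using sets by (simp add: emeasure_eq_measure)
    also have "\<dots> \<le> ennreal (\<tau> (real (m + j)))" by (intro ennreal_leI tail) simp
    finally show "ennreal (\<phi> (real (m + j) + 1)) * (\<integral>\<^sup>+x. 1 * indicator (- cball x0 (real (m + j))) x \<partial>\<rho>)
       \<le> ennreal (\<phi> (real (m + j) + 1) * \<tau> (real (m + j)))"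
      using pos[of "real (m + j) + 1"] \<tau>[of j] by (subst ennreal_mult) (auto intro!: mult_left_mono)
  qed (auto simp: emeasure_space_1)
  also have "\<dots> < \<infinity>"
  proof -
    have "summable (\<lambda>j. \<phi> (real (m + j) + 1) * \<tau> (real (m + j)))"
      using summable_ignore_initial_segment[OF sm, of m] by (simp add: add.commute)
    then have "(\<Sum>j. ennreal (\<phi> (real (m + j) + 1) * \<tau> (real (m + j))))
       = ennreal (\<Sum>j. \<phi> (real (m + j) + 1) * \<tau> (real (m + j)))"
      using pos \<tau> by (intro suminf_ennreal2 mult_nonneg_nonneg) auto
    then show ?thesis by (simp only: infinity_ennreal_def ennreal_add_less_top ennreal_less_top simp_thms)
  qed
  finally have fin: "(\<integral>\<^sup>+x. ennreal (\<phi> (dist x0 x)) \<partial>\<rho>) < \<infinity>" .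
  show ?thesis
  proof (rule integrableI_nonneg[OF _ _ fin])
    show "(\<lambda>x. \<phi> (dist x0 x)) \<in> borel_measurable \<rho>"
      by (rule borel_measurable_dist_centre[OF sets]) fact
    show "AE x in \<rho>. 0 \<le> \<phi> (dist x0 x)" by (intro AE_I2 pos) simp
  qed
qed

text \<open>The second tail condition at the radius m itself, with right-hand side 0, removes the
  negative part outside the ball; inside, the sign is part of the definition.\<close>

lemma coneF_nonneg:
  fixes x0 :: "'a::metric_space"
  assumes "prob_space \<rho>" and sets [measurable_cong]: "sets \<rho> = sets borel" and f: "f \<in> coneF x0 \<rho> m m \<alpha> (\<lambda>_. 0)"
  shows "AE x in \<rho>. 0 \<le> f x" "integrable \<rho> f"
proof -
  interpret prob_space \<rho> by fact
  have fm [measurable]: "f \<in> borel_measurable \<rho>" and f2: "integrable \<rho> (\<lambda>x. (f x)\<^sup>2)"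
    using f by (auto simp: coneF_def L2_def)
  show fi: "integrable \<rho> f" by (rule square_integrable_imp_integrable[OF fm f2])
  have ball: "AE x in \<rho>. x \<in> cball x0 m \<longrightarrow> 0 \<le> f x"
    and "set_lebesgue_integral \<rho> (- cball x0 m) (\<lambda>x. max (- f x) 0) \<le> 0 * integral\<^sup>L \<rho> f"
    using f by (auto simp: coneF_def)
  then have le: "(\<integral>x. indicator (- cball x0 m) x * max (- f x) 0 \<partial>\<rho>) \<le> 0"
    by (simp add: set_lebesgue_integral_def)
  have i: "integrable \<rho> (\<lambda>x. indicator (- cball x0 m) x * max (- f x) 0)"
    using integrable_mult_indicator[of "- cball x0 m" \<rho> "\<lambda>x. max (- f x) 0"] fi sets by simp
  have "(\<integral>x. indicator (- cball x0 m) x * max (- f x) 0 \<partial>\<rho>) = 0"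
    using le by (intro antisym integral_nonneg_AE) auto
  then have "AE x in \<rho>. indicator (- cball x0 m) x * max (- f x) 0 = 0"
    by (subst (asm) integral_nonneg_eq_0_iff_AE[OF i]) auto
  with ball show "AE x in \<rho>. 0 \<le> f x"
    by eventually_elim (auto simp: indicator_def split: if_splits)
qed

text \<open>The first tail condition is imposed at radii from m on, so the shells start at m and the
  ball contributes \<open>\<phi> m\<close>.\<close>

lemma coneF_weighted:
  fixes x0 :: "'a::metric_space" and \<phi> :: "real \<Rightarrow> real" and m :: nat
  assumes P: "prob_space \<rho>" and sets [measurable_cong]: "sets \<rho> = sets borel"
    and mono: "\<And>r r'. 0 \<le> r \<Longrightarrow> r \<le> r' \<Longrightarrow> \<phi> r \<le> \<phi> r'" and nn: "0 \<le> \<phi> 0"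
    and "\<phi> \<in> borel_measurable borel"
    and \<alpha>: "\<And>r. 0 < r \<Longrightarrow> 0 \<le> \<alpha> r" "summable (\<lambda>j. \<phi> (real j + 1) * \<alpha> (real j))" and m: "0 < m"
    and f: "f \<in> coneF x0 \<rho> m m \<alpha> (\<lambda>_. 0)"
  shows "(\<integral>x. f x * \<phi> (dist x0 x) \<partial>\<rho>) \<le> (\<phi> m + (\<Sum>j. \<phi> (real (m + j) + 1) * \<alpha> (real (m + j)))) * (\<integral>x. f x \<partial>\<rho>)"
proof -
  interpret prob_space \<rho> by fact
  have pos: "0 \<le> \<phi> r" if "0 \<le> r" for r using mono[of 0 r] nn that by simp
  note f0 = coneF_nonneg[OF P sets f]
  have [measurable]: "f \<in> borel_measurable \<rho>" using f0(2) by simp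
  have [measurable]: "(\<lambda>x. \<phi> (dist x0 x)) \<in> borel_measurable \<rho>"
    by (rule borel_measurable_dist_centre[OF sets]) fact
  have I0: "0 \<le> (\<integral>x. f x \<partial>\<rho>)" using f0(1) by (rule integral_nonneg_AE)
  have al: "0 \<le> \<alpha> (real (m + j))" for j using \<alpha>(1) m by simp
  have sm: "summable (\<lambda>j. \<phi> (real (m + j) + 1) * \<alpha> (real (m + j)))"
    using summable_ignore_initial_segment[OF \<alpha>(2), of m] by (simp add: add.commute)
  have S0: "0 \<le> (\<Sum>j. \<phi> (real (m + j) + 1) * \<alpha> (real (m + j)))"
    using pos al by (intro suminf_nonneg sm mult_nonneg_nonneg) auto
  have tail: "(\<integral>\<^sup>+x. ennreal (f x) * indicator (- cball x0 (real (m + j))) x \<partial>\<rho>)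
      \<le> ennreal (\<alpha> (real (m + j))) * ennreal (\<integral>x. f x \<partial>\<rho>)" for j
  proof -
    have i: "integrable \<rho> (\<lambda>x. indicator (- cball x0 (real (m + j))) x * max (f x) 0)"
      using integrable_mult_indicator[of "- cball x0 (real (m + j))" \<rho> "\<lambda>x. max (f x) 0"] f0(2) sets by simp
    have "(\<integral>\<^sup>+x. ennreal (f x) * indicator (- cball x0 (real (m + j))) x \<partial>\<rho>)
       = (\<integral>\<^sup>+x. ennreal (indicator (- cball x0 (real (m + j))) x * max (f x) 0) \<partial>\<rho>)"
      using f0(1) by (intro nn_integral_cong_AE) (auto elim!: eventually_mono simp: indicator_def max_def)
    also have "\<dots> = ennreal (\<integral>x. indicator (- cball x0 (real (m + j))) x * max (f x) 0 \<partial>\<rho>)"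
      by (intro nn_integral_eq_integral[OF i]) auto
    also have "\<dots> \<le> ennreal (\<alpha> (real (m + j)) * (\<integral>x. f x \<partial>\<rho>))"
      using f by (intro ennreal_leI) (auto simp: coneF_def set_lebesgue_integral_def)
    finally show ?thesis using al I0 by (simp add: ennreal_mult)
  qed
  have nnf: "(\<integral>\<^sup>+x. ennreal (f x) \<partial>\<rho>) = ennreal (\<integral>x. f x \<partial>\<rho>)"
    by (rule nn_integral_eq_integral[OF f0(2) f0(1)])
  define X where "X = (\<phi> m + (\<Sum>j. \<phi> (real (m + j) + 1) * \<alpha> (real (m + j)))) * (\<integral>x. f x \<partial>\<rho>)"
  have X0: "0 \<le> X" using pos S0 I0 by (simp add: X_def)
  have "(\<integral>\<^sup>+x. ennreal (f x * \<phi> (dist x0 x)) \<partial>\<rho>) = (\<integral>\<^sup>+x. ennreal (f x) * ennreal (\<phi> (dist x0 x)) \<partial>\<rho>)"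
    using pos by (intro nn_integral_cong_AE AE_I2) (simp add: ennreal_mult'')
  also have "\<dots> \<le> ennreal (\<phi> m) * (\<integral>\<^sup>+x. ennreal (f x) \<partial>\<rho>) +
      (\<Sum>j. ennreal (\<phi> (real (m + j) + 1)) * (\<integral>\<^sup>+x. ennreal (f x) * indicator (- cball x0 (real (m + j))) x \<partial>\<rho>))"
    by (rule nn_integral_radial_le[where \<phi> = \<phi>, OF sets _ _ nn]) (auto intro: mono)
  also have "\<dots> \<le> ennreal (\<phi> m) * ennreal (\<integral>x. f x \<partial>\<rho>) +
      (\<Sum>j. ennreal (\<phi> (real (m + j) + 1) * \<alpha> (real (m + j))) * ennreal (\<integral>x. f x \<partial>\<rho>))"
    unfolding nnf using tail pos al
    by (intro add_mono order.refl suminf_le) (auto simp: ennreal_mult mult.assoc intro!: mult_left_mono)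
  also have "\<dots> = ennreal ((\<phi> m + (\<Sum>j. \<phi> (real (m + j) + 1) * \<alpha> (real (m + j)))) * (\<integral>x. f x \<partial>\<rho>))"
  proof -
    have "(\<Sum>j. ennreal (\<phi> (real (m + j) + 1) * \<alpha> (real (m + j))) * ennreal (\<integral>x. f x \<partial>\<rho>))
        = ennreal (\<Sum>j. \<phi> (real (m + j) + 1) * \<alpha> (real (m + j))) * ennreal (\<integral>x. f x \<partial>\<rho>)"
      unfolding ennreal_suminf_multc
      using pos al sm by (subst suminf_ennreal2) (auto intro!: mult_nonneg_nonneg)
    then show ?thesis
      using pos[of "real m"] S0 I0
      by (simp only: ennreal_mult[symmetric] distrib_right ennreal_plus[symmetric] mult_nonneg_nonneg of_nat_0_le_iff)
  qed
  finally have le: "(\<integral>\<^sup>+x. ennreal (f x * \<phi> (dist x0 x)) \<partial>\<rho>) \<le> ennreal X" by (simp add: X_def)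
  have "(\<integral>x. f x * \<phi> (dist x0 x) \<partial>\<rho>) = enn2real (\<integral>\<^sup>+x. ennreal (f x * \<phi> (dist x0 x)) \<partial>\<rho>)"
  proof (rule integral_eq_nn_integral)
    show "AE x in \<rho>. 0 \<le> f x * \<phi> (dist x0 x)" using f0(1) by eventually_elim (simp add: pos)
  qed measurable
  also have "\<dots> \<le> enn2real (ennreal X)" by (intro enn2real_mono le) simp
  finally show ?thesis using X0 by (simp add: X_def)
qed

text \<open>For \<open>f\<close> in the first cone the integral of \<open>f * w\<close> is at least
  \<open>c1 - c2 * K\<close> times that of \<open>f\<close>. The bound \<open>up\<close> puts
  \<open>w\<close> into L2, the square of \<open>exp (2 * S x)\<close> being
  \<open>exp (4 * S x)\<close>.\<close>

lemma coneG_intro: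
  fixes x0 :: "'a::metric_space"
  assumes P: "prob_space \<rho>" and sets: "sets \<rho> = sets borel"
    and S [measurable]: "S \<in> borel_measurable \<rho>" and Si: "integrable \<rho> (\<lambda>x. exp (4 * S x))"
    and K: "\<And>f. f \<in> coneF x0 \<rho> m m \<alpha> (\<lambda>_. 0) \<Longrightarrow> (\<integral>x. f x * exp (2 * S x) \<partial>\<rho>) \<le> K * (\<integral>x. f x \<partial>\<rho>)"
    and w [measurable]: "w \<in> borel_measurable \<rho>"
    and up: "AE x in \<rho>. \<bar>w x\<bar> \<le> A * exp (2 * S x)" and lo: "AE x in \<rho>. c1 - c2 * exp (2 * S x) \<le> w x"
    and c: "0 \<le> c2" "c2 * K \<le> c1"
  shows "w \<in> coneG x0 \<rho> m m \<alpha> (\<lambda>_. 0)"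
proof -
  interpret prob_space \<rho> by fact
  have e4: "(exp (2 * S x))\<^sup>2 = exp (4 * S x)" for x by (simp add: power2_eq_square exp_add[symmetric])
  have w2: "integrable \<rho> (\<lambda>x. (w x)\<^sup>2)"
  proof (rule Bochner_Integration.integrable_bound[OF integrable_mult_right[OF Si, of "A\<^sup>2"]])
    show "AE x in \<rho>. norm ((w x)\<^sup>2) \<le> norm (A\<^sup>2 * exp (4 * S x))"
      using up
    proof eventually_elim
      case (elim x)
      have "\<bar>w x\<bar>\<^sup>2 \<le> (A * exp (2 * S x))\<^sup>2" by (rule power_mono[OF elim]) simp
      then show ?case by (simp add: power_mult_distrib e4 del: power_mult_distrib[symmetric])
    qed
  qed simp
  have "0 \<le> (\<integral>x. f x * w x \<partial>\<rho>)" if f: "f \<in> coneF x0 \<rho> m m \<alpha> (\<lambda>_. 0)" for f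
  proof -
    note f0 = coneF_nonneg[OF P sets f]
    have fm [measurable]: "f \<in> borel_measurable \<rho>" and f2: "integrable \<rho> (\<lambda>x. (f x)\<^sup>2)"
      using f by (auto simp: coneF_def L2_def)
    have prod: "\<bar>a * b\<bar> \<le> a\<^sup>2 + b\<^sup>2" for a b :: real
      using sum_squares_bound[of "\<bar>a\<bar>" "\<bar>b\<bar>"] mult_nonneg_nonneg[of "\<bar>a\<bar>" "\<bar>b\<bar>"]
      unfolding abs_mult power2_abs by linarith
    have fw: "integrable \<rho> (\<lambda>x. f x * w x)"
      by (rule Bochner_Integration.integrable_bound[OF Bochner_Integration.integrable_add[OF f2 w2]])
         (use prod in \<open>auto intro!: AE_I2 order_trans[OF prod]\<close>)
    have fe: "integrable \<rho> (\<lambda>x. f x * exp (2 * S x))"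
      by (rule Bochner_Integration.integrable_bound[OF Bochner_Integration.integrable_add[OF f2 Si]])
         (use prod in \<open>auto intro!: AE_I2 order_trans[OF prod] simp: e4\<close>)
    have "c2 * (\<integral>x. f x * exp (2 * S x) \<partial>\<rho>) \<le> c2 * (K * (\<integral>x. f x \<partial>\<rho>))"
      using K[OF f] c by (intro mult_left_mono) auto
    also have "\<dots> \<le> c1 * (\<integral>x. f x \<partial>\<rho>)"
      using c mult_right_mono[OF c(2) integral_nonneg_AE[OF f0(1)]] by (simp add: mult.assoc)
    finally have "0 \<le> (\<integral>x. c1 * f x - c2 * (f x * exp (2 * S x)) \<partial>\<rho>)"
      using f0(2) fe by simp
    also have "\<dots> \<le> (\<integral>x. f x * w x \<partial>\<rho>)"
    proof (rule integral_mono_AE)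
      show "AE x in \<rho>. c1 * f x - c2 * (f x * exp (2 * S x)) \<le> f x * w x"
        using f0(1) lo
      proof eventually_elim
        case (elim x)
        from mult_left_mono[OF elim(2) elim(1)] show ?case by (simp add: algebra_simps)
      qed
    qed (use f0(2) fe fw in auto)
    finally show ?thesis .
  qed
  then show ?thesis using w2 by (simp add: coneG_def L2_def)
qed

text \<open>A test function that pairs strictly positively with every function bounded below, once
  the ball has mass. It shows that the set in \<open>hilbert_m\<close> is bounded above, so that its
  real supremum is meaningful.\<close>

lemma indicator_mem_coneF:
  fixes x0 :: "'a::metric_space"
  assumes P: "prob_space \<rho>" and sets: "sets \<rho> = sets borel" and \<alpha>: "\<And>r. 0 < r \<Longrightarrow> 0 \<le> \<alpha> r" and m: "0 < m"
  shows "indicator (cball x0 m) \<in> coneF x0 \<rho> m m \<alpha> (\<lambda>_. 0)"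
proof -
  interpret prob_space \<rho> by fact
  have [measurable]: "cball x0 m \<in> events" using sets by simp
  have "integrable \<rho> (indicator (cball x0 m) :: 'a \<Rightarrow> real)"
    by (rule integrable_real_indicator) (auto simp: emeasure_eq_measure)
  moreover have sq: "(\<lambda>x. (indicator (cball x0 m) x)\<^sup>2) = (indicator (cball x0 m) :: 'a \<Rightarrow> real)"
    by (auto simp: indicator_def fun_eq_iff)
  moreover have "(\<lambda>x. indicator (- cball x0 r) x *\<^sub>R max (indicator (cball x0 m) x) 0) = (\<lambda>_. 0 :: real)" if "m \<le> r" for r
    using that by (auto simp: indicator_def fun_eq_iff)
  moreover have "(\<lambda>x. indicator (- cball x0 r) x *\<^sub>R max (- indicator (cball x0 m) x) 0) = (\<lambda>_. 0 :: real)" for r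
    by (auto simp: indicator_def fun_eq_iff)
  moreover have "0 \<le> \<alpha> r * measure \<rho> (cball x0 m)" if "m \<le> r" for r using \<alpha>[of r] m that by simp
  ultimately show ?thesis
    by (auto simp: coneF_def L2_def sq set_lebesgue_integral_def)
qed

text \<open>Relative slack \<open>\<tau>\<close> on either side of \<open>exp q * g\<close> absorbs
  the error \<open>d * exp (2 * S x)\<close>. The scalar \<open>exp q\<close> cancels in the product
  \<open>b * b'\<close>, leaving the logarithm of the square of \<open>1 + \<tau>\<close>.\<close>

lemma hilbert_dist_le:
  fixes x0 :: "'a::metric_space"
  assumes P: "prob_space \<rho>" and sets: "sets \<rho> = sets borel"
    and S [measurable]: "S \<in> borel_measurable \<rho>" and S0: "\<And>x. 0 \<le> S x" and Si: "integrable \<rho> (\<lambda>x. exp (4 * S x))"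
    and K: "\<And>f. f \<in> coneF x0 \<rho> m m \<alpha> (\<lambda>_. 0) \<Longrightarrow> (\<integral>x. f x * exp (2 * S x) \<partial>\<rho>) \<le> K * (\<integral>x. f x \<partial>\<rho>)"
    and K0: "0 \<le> K"
    and \<alpha>: "\<And>r. 0 < r \<Longrightarrow> 0 \<le> \<alpha> r" and m: "0 < m" "0 < measure \<rho> (cball x0 m)"
    and g [measurable]: "g \<in> borel_measurable \<rho>" "h \<in> borel_measurable \<rho>"
    and l: "0 < l" and gb: "AE x in \<rho>. l \<le> g x \<and> g x \<le> u * exp (S x)"
    and hb: "AE x in \<rho>. l \<le> h x \<and> h x \<le> u * exp (S x)"
    and q: "\<bar>q\<bar> \<le> Q" and d: "0 \<le> d" and close: "AE x in \<rho>. \<bar>h x - exp q * g x\<bar> \<le> d * exp (2 * S x)"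
  shows "hilbert_dist \<rho> (coneG x0 \<rho> m m \<alpha> (\<lambda>_. 0)) g h \<le> ereal (2 * (K * exp Q / l) * d)"
proof -
  interpret prob_space \<rho> by fact
  let ?G = "coneG x0 \<rho> m m \<alpha> (\<lambda>_. 0)"
  \<comment> \<open>Chosen so that \<open>\<tau> * l\<close> dominates \<open>d * K\<close>; the
    factor \<open>exp Q\<close> provides for multiplication by \<open>exp q\<close>, which may be as
    small as \<open>exp (- Q)\<close>.\<close>
  define \<tau> where "\<tau> = d * K * exp Q / l"
  have \<tau>0: "0 \<le> \<tau>" using d K0 l by (simp add: \<tau>_def)
  have dK: "0 \<le> d * K" using d K0 by simp
  have \<tau>l: "d * K \<le> \<tau> * l * exp q"  "d * K \<le> \<tau> * l"
  proof -
    have t: "\<tau> * l = d * K * exp Q" using l by (simp add: \<tau>_def)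
    have "1 \<le> exp Q * exp q" "1 \<le> exp Q" using q by (auto simp: exp_add[symmetric])
    from mult_left_mono[OF this(1) dK] mult_left_mono[OF this(2) dK]
    show "d * K \<le> \<tau> * l * exp q"  "d * K \<le> \<tau> * l" unfolding t by (auto simp: mult.assoc)
  qed
  have small: "\<bar>a * v - b * w\<bar> \<le> ((\<bar>a\<bar> + \<bar>b\<bar>) * u) * exp (2 * S x)"
    if "l \<le> v \<and> v \<le> u * exp (S x)" "l \<le> w \<and> w \<le> u * exp (S x)" for a b v w x
  proof -
    have u: "0 < u" using that(1) l by (smt (verit) exp_gt_zero mult_nonpos_nonneg)
    have "u * exp (S x) \<le> u * exp (2 * S x)" using u S0[of x] by simp
    then have vw: "\<bar>v\<bar> \<le> u * exp (2 * S x)" "\<bar>w\<bar> \<le> u * exp (2 * S x)" using that l by auto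
    have "\<bar>a * v - b * w\<bar> \<le> \<bar>a\<bar> * \<bar>v\<bar> + \<bar>b\<bar> * \<bar>w\<bar>" by (simp add: abs_mult[symmetric])
    also have "\<dots> \<le> \<bar>a\<bar> * (u * exp (2 * S x)) + \<bar>b\<bar> * (u * exp (2 * S x))"
      using vw by (intro add_mono mult_left_mono) auto
    finally show ?thesis by (simp add: algebra_simps)
  qed
  define b where "b = exp (- q) * (1 + \<tau>)"
  define b' where "b' = exp q * (1 + \<tau>)"
  have b0: "0 < b" "0 < b'" using \<tau>0 by (auto simp: b_def b'_def)
  have bb: "b * b' = (1 + \<tau>)\<^sup>2" by (simp add: b_def b'_def power2_eq_square exp_minus)
  have M: "(\<lambda>x. b * h x - g x) \<in> ?G"
  proof (rule coneG_intro[OF P sets S Si K])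
    show "AE x in \<rho>. \<bar>b * h x - g x\<bar> \<le> ((\<bar>b\<bar> + \<bar>1\<bar>) * u) * exp (2 * S x)"
      using gb hb by eventually_elim (use small[of _ _ _ b 1] in simp)
    show "AE x in \<rho>. exp (- q) * (\<tau> * l) - exp (- q) * d * exp (2 * S x) \<le> b * h x - g x"
      using hb close
    proof eventually_elim
      case (elim x)
      have "b * h x - g x = exp (- q) * ((h x - exp q * g x) + \<tau> * h x)"
        by (simp add: b_def algebra_simps exp_minus)
      moreover have "- (d * exp (2 * S x)) + \<tau> * l \<le> (h x - exp q * g x) + \<tau> * h x"
        using elim \<tau>0 by (intro add_mono mult_left_mono) auto
      ultimately show ?case
        using mult_left_mono[of "- (d * exp (2 * S x)) + \<tau> * l" "(h x - exp q * g x) + \<tau> * h x" "exp (- q)"]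
        by (simp add: algebra_simps)
    qed
    show "exp (- q) * d * K \<le> exp (- q) * (\<tau> * l)" using \<tau>l by simp
  qed (use d in auto)
  have M': "(\<lambda>x. b' * g x - h x) \<in> ?G" and m': "(\<lambda>x. g x - (1 / b') * h x) \<in> ?G"
  proof -
    have lo: "AE x in \<rho>. exp q * (\<tau> * l) - d * exp (2 * S x) \<le> b' * g x - h x"
      using gb close
    proof eventually_elim
      case (elim x)
      have "exp q * (\<tau> * l) \<le> exp q * (\<tau> * g x)" using elim \<tau>0 by (intro mult_left_mono) auto
      moreover have "b' * g x - h x = - (h x - exp q * g x) + exp q * (\<tau> * g x)"
        by (simp add: b'_def algebra_simps)
      ultimately show ?case using elim by linarith
    qed
    show "(\<lambda>x. b' * g x - h x) \<in> ?G"
    proof (rule coneG_intro[OF P sets S Si K _ _ lo])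
      show "AE x in \<rho>. \<bar>b' * g x - h x\<bar> \<le> ((\<bar>b'\<bar> + \<bar>1\<bar>) * u) * exp (2 * S x)"
        using gb hb by eventually_elim (use small[of _ _ _ b' 1] in simp)
      show "d * K \<le> exp q * (\<tau> * l)" using \<tau>l by (simp add: mult.commute)
    qed (use d in auto)
    \<comment> \<open>This is the previous function divided by \<open>b'\<close>; the same lower
      bound is rescaled.\<close>
    show "(\<lambda>x. g x - (1 / b') * h x) \<in> ?G"
    proof (rule coneG_intro[OF P sets S Si K])
      show "AE x in \<rho>. \<bar>g x - (1 / b') * h x\<bar> \<le> ((\<bar>1\<bar> + \<bar>1 / b'\<bar>) * u) * exp (2 * S x)"
        using gb hb by eventually_elim (use small[of _ _ _ 1 "1 / b'"] in simp)
      show "AE x in \<rho>. exp q * (\<tau> * l) / b' - d / b' * exp (2 * S x) \<le> g x - (1 / b') * h x"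
        using lo
      proof eventually_elim
        case (elim x)
        from divide_right_mono[OF this, of b'] show ?case using b0 by (simp add: diff_divide_distrib)
      qed
      show "d / b' * K \<le> exp q * (\<tau> * l) / b'"
        using \<tau>l b0 by (simp add: divide_right_mono mult.commute)
    qed (use d b0 in auto)
  qed
  have comp: "cone_comparable ?G g h"
    unfolding cone_comparable_def cone_le_def using M M' b0 by blast
  have nz: "\<not> (AE x in \<rho>. h x = 0)"
  proof
    assume "AE x in \<rho>. h x = 0"
    with hb have "AE x in \<rho>. False" by eventually_elim (use l in auto)
    then show False by simp
  qed
  have Mle: "hilbert_M ?G g h \<le> b" unfolding hilbert_M_def
    by (rule cInf_lower) (use M b0 in \<open>auto intro!: bdd_belowI[of _ 0]\<close>)
  have Mge: "0 \<le> hilbert_M ?G g h" unfolding hilbert_M_def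
    by (rule cInf_greatest) (use M b0 in auto)
  have mge: "1 / b' \<le> hilbert_m ?G g h" unfolding hilbert_m_def
  proof (rule cSup_upper)
    let ?f = "indicator (cball x0 m) :: 'a \<Rightarrow> real"
    have [measurable]: "cball x0 m \<in> events" using sets by simp
    have "integrable \<rho> ?f" by (rule integrable_real_indicator) (auto simp: emeasure_eq_measure)
    then have fi: "integrable \<rho> (\<lambda>x. ?f x * l)" by simp
    have fF: "?f \<in> coneF x0 \<rho> m m \<alpha> (\<lambda>_. 0)" by (rule indicator_mem_coneF[OF P sets \<alpha> m(1)])
    have i: "integrable \<rho> (\<lambda>x. ?f x * v x)" if v [measurable]: "v \<in> borel_measurable \<rho>"
      and "AE x in \<rho>. l \<le> v x \<and> v x \<le> u * exp (S x)" for v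
    proof (rule Bochner_Integration.integrable_bound[OF integrable_mult_right[OF Si, of u]])
      show "AE x in \<rho>. norm (?f x * v x) \<le> norm (u * exp (4 * S x))"
        using that(2)
      proof eventually_elim
        case (elim x)
        have "exp (2 * S x) \<le> exp (4 * S x)" using S0[of x] by simp
        moreover have "\<bar>v x\<bar> \<le> u * exp (2 * S x)" using small[OF elim elim, of 1 0] by simp
        moreover have u: "0 < u" using elim l by (smt (verit) exp_gt_zero mult_nonpos_nonneg)
        ultimately have "\<bar>v x\<bar> \<le> u * exp (4 * S x)" by (meson mult_left_mono less_imp_le order_trans)
        then show ?case using u by (auto simp: indicator_def)
      qed
    qed simp
    have "l * measure \<rho> (cball x0 m) = (\<integral>x. ?f x * l \<partial>\<rho>)" by simp
    also have "\<dots> \<le> (\<integral>x. ?f x * h x \<partial>\<rho>)"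
    proof (rule integral_mono_AE)
      show "AE x in \<rho>. ?f x * l \<le> ?f x * h x" using hb by eventually_elim (auto simp: indicator_def)
    qed (use i[OF g(2) hb] fi in auto)
    finally have hpos: "0 < (\<integral>x. ?f x * h x \<partial>\<rho>)" using l m by (smt (verit) mult_pos_pos)
    have "a \<le> (\<integral>x. ?f x * g x \<partial>\<rho>) / (\<integral>x. ?f x * h x \<partial>\<rho>)" if a: "(\<lambda>x. g x - a * h x) \<in> ?G" for a
    proof -
      have "0 \<le> (\<integral>x. ?f x * (g x - a * h x) \<partial>\<rho>)" using a fF unfolding coneG_def by blast
      also have "\<dots> = (\<integral>x. ?f x * g x - a * (?f x * h x) \<partial>\<rho>)"
        by (intro Bochner_Integration.integral_cong) (auto simp: algebra_simps)
      also have "\<dots> = (\<integral>x. ?f x * g x \<partial>\<rho>) - a * (\<integral>x. ?f x * h x \<partial>\<rho>)"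
        using i[OF g(1) gb] i[OF g(2) hb] by simp
      finally show ?thesis using hpos by (simp add: pos_le_divide_eq)
    qed
    then show "bdd_above {a. 0 < a \<and> (\<lambda>x. g x - a * h x) \<in> ?G}" by (auto intro!: bdd_aboveI)
  qed (use m' b0 in simp)
  have mpos: "0 < hilbert_m ?G g h" using mge b0 by (smt (verit) divide_pos_pos)
  have "hilbert_M ?G g h / hilbert_m ?G g h \<le> b / (1 / b')"
    using Mle Mge mge b0 by (intro frac_le) auto
  also have "\<dots> = (1 + \<tau>)\<^sup>2" using bb by simp
  finally have R: "hilbert_M ?G g h / hilbert_m ?G g h \<le> (1 + \<tau>)\<^sup>2" .
  have "ln (hilbert_M ?G g h / hilbert_m ?G g h) \<le> 2 * \<tau>"
  \<comment> \<open>The infimum is known only to be nonnegative; at 0 the logarithm takes its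
    default value 0.\<close>
  proof (cases "hilbert_M ?G g h = 0")
    case True
    then show ?thesis using \<tau>0 by simp
  next
    case False
    then have "0 < hilbert_M ?G g h / hilbert_m ?G g h" using Mge mpos by simp
    then have "ln (hilbert_M ?G g h / hilbert_m ?G g h) \<le> ln ((1 + \<tau>)\<^sup>2)" using R \<tau>0 by (subst ln_le_cancel_iff) auto
    also have "\<dots> = 2 * ln (1 + \<tau>)" using \<tau>0 by (simp add: ln_realpow)
    also have "\<dots> \<le> 2 * \<tau>" using \<tau>0 by (simp add: ln_add_one_self_le_self)
    finally show ?thesis .
  qed
  then show ?thesis using comp nz unfolding hilbert_dist_def by (simp add: \<tau>_def mult_ac)
qed

section \<open>Sinkhorn iterates under the growth and tail conditions\<close>

text \<open>The power p + \<delta> beats any multiple of the power p. The shift by one pairs the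
  outer radius of a shell with the tail at its inner radius.\<close>

lemma summable_exp_powr_diff:
  fixes p \<delta> \<epsilon> K :: real
  assumes "0 < p" "0 < \<delta>" "0 < \<epsilon>"
  shows "summable (\<lambda>j. exp (4 * ((K + (real j + 1) powr p) / \<epsilon>)) * exp (- (real j powr (p + \<delta>))))"
proof (rule summable_comparison_test_bigo)
  show "summable (\<lambda>j. norm (1 / real j ^ 2))" using inverse_power_summable[of 2, where 'a = real] by (simp add: field_simps)
  show "(\<lambda>j. exp (4 * ((K + (real j + 1) powr p) / \<epsilon>)) * exp (- (real j powr (p + \<delta>)))) \<in> O(\<lambda>j. 1 / real j ^ 2)"
    using assms by real_asymp
qed

text \<open>A completed sweep normalizes the second marginal, so every Sinkhorn coupling after the
  initial one has mass one.\<close>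

lemma (in bounded_kernel) pair_mass_dual:
  assumes a: "adm M s l u a"
  shows "(\<integral>(x,y). k x y * a x * sch M (\<lambda>y x. k x y) a y \<partial>(M \<Otimes>\<^sub>M N)) = 1"
proof -
  interpret D: bounded_kernel N M "\<lambda>y x. k x y" t s by (rule dual)
  interpret P: pair_sigma_finite M N ..
  let ?b = "sch M (\<lambda>y x. k x y) a"
  obtain l' u' where b: "adm N t l' u' ?b" using D.sch_adm_exists[OF a] by blast
  have "(\<integral>(x,y). k x y * a x * ?b y \<partial>(M \<Otimes>\<^sub>M N)) = (\<integral>y. (\<integral>x. k x y * a x * ?b y \<partial>M) \<partial>N)"
    using P.integral_snd[OF pair_integrable[OF b a]] by simp
  also have "\<dots> = (\<integral>y. 1 \<partial>N)"
  proof (rule Bochner_Integration.integral_cong[OF refl])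
    fix y
    have "(\<integral>x. k x y * a x * ?b y \<partial>M) = D.Z a y * ?b y" by (simp add: kint_def)
    also have "\<dots> = 1" using D.Z_pos[OF a, of y] by (simp add: sch_def)
    finally show "(\<integral>x. k x y * a x * ?b y \<partial>M) = 1" .
  qed
  finally show ?thesis by (simp add: N.prob_space)
qed

lemma (in bounded_kernel) pair_mass_const_le: "(\<integral>(x,y). k x y * 1 * 1 \<partial>(M \<Otimes>\<^sub>M N)) \<le> 1"
proof -
  interpret PP: pair_prob_space M N ..
  interpret D: bounded_kernel N M "\<lambda>y x. k x y" t s by (rule dual)
  have "adm N t 1 1 (\<lambda>_. 1)" "adm M s 1 1 (\<lambda>_. 1)" using t_nonneg s_nonneg by (auto simp: adm_def)
  from pair_integrable[OF this] show ?thesis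
    by (intro PP.integral_le_const) (auto simp: k_le_1 intro!: AE_I2)
qed

text \<open>For a nonnegative measurable integrand the two integrals also agree when they diverge,
  both being 0 after \<open>enn2real\<close>.\<close>

lemma T_nu_eq_sch:
  assumes "(\<lambda>y. exp (- c (x, y) / \<epsilon>)) \<in> borel_measurable \<nu>" "g \<in> borel_measurable \<nu>" "\<And>y. 0 \<le> g y"
  shows "T_nu \<nu> c \<epsilon> g x = sch \<nu> (\<lambda>x y. exp (- c (x, y) / \<epsilon>)) g x"
  unfolding T_nu_def sch_def kint_def using assms by (subst integral_eq_nn_integral) auto

lemma T_mu_eq_sch:
  assumes "(\<lambda>x. exp (- c (x, y) / \<epsilon>)) \<in> borel_measurable \<mu>" "g \<in> borel_measurable \<mu>" "\<And>y. 0 \<le> g y"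
  shows "T_mu \<mu> c \<epsilon> g y = sch \<mu> (\<lambda>y x. exp (- c (x, y) / \<epsilon>)) g y"
  unfolding T_mu_def sch_def kint_def using assms by (subst integral_eq_nn_integral) auto

lemma (in bounded_kernel) sch_nonneg_measurable:
  assumes "g \<in> borel_measurable N" "\<And>y. 0 \<le> g y"
  shows "sch N k g \<in> borel_measurable M" "0 \<le> sch N k g x"
proof -
  note [measurable] = assms(1)
  show "sch N k g \<in> borel_measurable M" unfolding sch_def[abs_def] by measurable
  show "0 \<le> sch N k g x" unfolding sch_def kint_def
    using assms(2) k_pos by (intro divide_nonneg_nonneg integral_nonneg_AE) (auto simp: less_imp_le)
qed

text \<open>An equality almost everywhere becomes one at every point after integration; this
  upgrades the Schroedinger equations.\<close>

lemma (in bounded_kernel) sch_cong_AE: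
  assumes "g \<in> borel_measurable N" "h \<in> borel_measurable N" "AE y in N. g y = h y"
  shows "sch N k g = sch N k h"
proof -
  note [measurable] = assms(1,2)
  have "kint N k g x = kint N k h x" for x
    unfolding kint_def by (rule integral_cong_AE) (use assms(3) in auto)
  then show ?thesis by (simp add: sch_def fun_eq_iff)
qed

text \<open>At the radius r, the maximum of \<open>r1\<close> and the two distances, the quotient is
  below 1, so the cost is at most \<open>r powr p\<close>, which is one of the three summands. A
  quotient below 1 also excludes an infinite supremum.\<close>

lemma locally_bounded_cost:
  fixes c :: "'a::metric_space \<times> 'a \<Rightarrow> real"
  assumes p: "0 < p"
    and lim: "((\<lambda>r. (SUP z \<in> cball x0 r \<times> cball x0 r. ereal (c z)) / ereal (r powr p)) \<longlongrightarrow> 0) at_top"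
  obtains K where "0 \<le> K" "\<And>x y. c (x, y) \<le> K + dist x0 x powr p + dist x0 y powr p"
proof -
  have "eventually (\<lambda>r. (SUP z \<in> cball x0 r \<times> cball x0 r. ereal (c z)) / ereal (r powr p) < 1) at_top"
    by (rule order_tendstoD(2)[OF lim]) simp
  then obtain r0 where r0: "\<And>r. r0 \<le> r \<Longrightarrow> (SUP z \<in> cball x0 r \<times> cball x0 r. ereal (c z)) / ereal (r powr p) < 1"
    by (auto simp: eventually_at_top_linorder)
  define r1 where "r1 = max r0 1"
  have "c (x, y) \<le> r1 powr p + dist x0 x powr p + dist x0 y powr p" for x y
  proof -
    define r where "r = max r1 (max (dist x0 x) (dist x0 y))"
    have r: "r0 \<le> r" "1 \<le> r" by (auto simp: r_def r1_def)
    have rp: "0 < r powr p" using r by simp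
    have "ereal (c (x, y)) \<le> (SUP z \<in> cball x0 r \<times> cball x0 r. ereal (c z))"
      by (intro SUP_upper) (auto simp: r_def)
    then have "ereal (c (x, y)) / ereal (r powr p) \<le> (SUP z \<in> cball x0 r \<times> cball x0 r. ereal (c z)) / ereal (r powr p)"
      using rp by (intro ereal_divide_right_mono) auto
    also have "\<dots> < 1" by (rule r0[OF r(1)])
    finally have "c (x, y) / r powr p < 1" using rp by simp
    then have "c (x, y) \<le> r powr p" using rp by (simp add: pos_divide_less_eq)
    also have "\<dots> \<le> r1 powr p + dist x0 x powr p + dist x0 y powr p"
      by (auto simp: r_def max_def add_increasing add_increasing2)
    finally show ?thesis .
  qed
  then show ?thesis by (intro that[of "r1 powr p"]) auto
qed

lemma exponential_tail:
  fixes x0 :: "'a::metric_space"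
  assumes lim: "((\<lambda>r. max (measure \<mu> (- cball x0 r)) (measure \<nu> (- cball x0 r))
               / exp (- (r powr q))) \<longlongrightarrow> 0) at_top"
  obtains m :: nat where "0 < m" "\<And>r. real m \<le> r \<Longrightarrow> measure \<mu> (- cball x0 r) \<le> exp (- (r powr q))"
    "\<And>r. real m \<le> r \<Longrightarrow> measure \<nu> (- cball x0 r) \<le> exp (- (r powr q))"
proof -
  have "eventually (\<lambda>r. max (measure \<mu> (- cball x0 r)) (measure \<nu> (- cball x0 r)) / exp (- (r powr q)) < 1) at_top"
    by (rule order_tendstoD(2)[OF lim]) simp
  then obtain r0 where r0: "\<And>r. r0 \<le> r \<Longrightarrow> max (measure \<mu> (- cball x0 r)) (measure \<nu> (- cball x0 r)) / exp (- (r powr q)) < 1"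
    by (auto simp: eventually_at_top_linorder)
  define m where "m = nat \<lceil>max r0 1\<rceil>"
  have m: "0 < m" "r0 \<le> real m" by (auto simp: m_def) linarith+
  have "max (measure \<mu> (- cball x0 r)) (measure \<nu> (- cball x0 r)) \<le> exp (- (r powr q))" if "real m \<le> r" for r
    using r0[of r] m that by (simp add: pos_divide_less_eq del: max_less_iff_conj max.bounded_iff)
  then show ?thesis using m by (intro that[of m]) auto
qed

lemma measure_cball_pos:
  fixes x0 :: "'a::metric_space"
  assumes "prob_space M" "sets M = sets borel" "measure M (- cball x0 r) < 1"
  shows "0 < measure M (cball x0 r)"
proof -
  interpret prob_space M by fact
  have "space M = UNIV" using sets_eq_imp_space_eq[OF assms(2)] by simp
  then have "measure M (- cball x0 r) = 1 - measure M (cball x0 r)"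
    using prob_compl[of "cball x0 r"] assms(2) by (simp add: Compl_eq_Diff_UNIV)
  then show ?thesis using assms(3) by simp
qed

text \<open>The argument \<open>r + 1\<close> cancels the weight at the outer radius of a shell and
  leaves a geometric series.\<close>

lemma tail_function_exp_divide:
  assumes "\<And>r r'. 0 \<le> r \<Longrightarrow> r \<le> r' \<Longrightarrow> \<phi> r \<le> \<phi> r'" "1 \<le> \<phi> 0"
  shows "tail_function (\<lambda>r. exp (- r) / \<phi> (r + 1))"
  unfolding tail_function_def
proof (intro conjI allI impI)
  have ge: "1 \<le> \<phi> r" if "0 \<le> r" for r using assms(1)[of 0 r] assms(2) that by simp
  show "0 \<le> exp (- r) / \<phi> (r + 1)" if "0 < r" for r using ge[of "r + 1"] that by simp
  show "exp (- r') / \<phi> (r' + 1) \<le> exp (- r) / \<phi> (r + 1)" if "0 < r" "r \<le> r'" for r r'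
    using ge[of "r + 1"] assms(1)[of "r + 1" "r' + 1"] that by (intro frac_le) auto
  show "((\<lambda>r. exp (- r) / \<phi> (r + 1)) \<longlongrightarrow> 0) at_top"
  proof (rule tendsto_sandwich[of "\<lambda>_. 0" _ _ "\<lambda>r. exp (- r)"])
    show "((\<lambda>r::real. exp (- r)) \<longlongrightarrow> 0) at_top" by real_asymp
    show "\<forall>\<^sub>F r in at_top. 0 \<le> exp (- r) / \<phi> (r + 1)"
      using eventually_ge_at_top[of 0]
    proof eventually_elim
      case (elim r)
      then show ?case using ge[of "r + 1"] by simp
    qed
    show "\<forall>\<^sub>F r in at_top. exp (- r) / \<phi> (r + 1) \<le> exp (- r)"
      using eventually_ge_at_top[of 0]
    proof eventually_elim
      case (elim r)
      have "exp (- r) / \<phi> (r + 1) \<le> exp (- r) / 1"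
        using ge[of "r + 1"] elim by (intro divide_left_mono) auto
      then show ?case by simp
    qed
  qed simp
qed

theorem theorem1p2:
  fixes \<mu> \<nu> :: "'a::polish_space measure"
    and x0 :: 'a
    and c :: "'a \<times> 'a \<Rightarrow> real"
    and \<epsilon> p \<delta> :: real
    and g1s g2s :: "'a \<Rightarrow> real"
  assumes "prob_space \<mu>" and "sets \<mu> = sets borel"
    and "prob_space \<nu>" and "sets \<nu> = sets borel"
    and "\<epsilon> > 0"
    and "c \<in> borel_measurable (\<mu> \<Otimes>\<^sub>M \<nu>)" and "\<And>z. 0 \<le> c z"
    and "(\<integral>\<^sup>+ z. ennreal (c z) \<partial>(\<mu> \<Otimes>\<^sub>M \<nu>)) < \<infinity>"
    and "p > 0" and "\<delta> > 0"
    and "((\<lambda>r. (SUP z \<in> cball x0 r \<times> cball x0 r. ereal (c z)) / ereal (r powr p))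
            \<longlongrightarrow> 0) at_top"
    and "((\<lambda>r. max (measure \<mu> (- cball x0 r)) (measure \<nu> (- cball x0 r))
               / exp (- (r powr (p + \<delta>)))) \<longlongrightarrow> 0) at_top"
    and "g1s \<in> borel_measurable \<mu>" and "g2s \<in> borel_measurable \<nu>"
    and "\<And>x. g1s x > 0" and "\<And>y. g2s y > 0"
    and "AE x in \<mu>. g1s x = T_nu \<nu> c \<epsilon> g2s x"
    and "AE y in \<nu>. g2s y = T_mu \<mu> c \<epsilon> g1s y"
  shows "\<exists>m1 m2 \<alpha>1 \<alpha>1' m1' m2' \<alpha>2 \<alpha>2' A \<kappa>.
           0 < m1 \<and> m1 \<le> m2 \<and> tail_function \<alpha>1 \<and> tail_function \<alpha>1' \<and>
           (\<forall>r > 0. \<alpha>1 r > 0) \<and> measure \<mu> (cball x0 m1) > 0 \<and>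
           0 < m1' \<and> m1' \<le> m2' \<and> tail_function \<alpha>2 \<and> tail_function \<alpha>2' \<and>
           (\<forall>r > 0. \<alpha>2 r > 0) \<and> measure \<nu> (cball x0 m1') > 0 \<and>
           A > 0 \<and> 0 < \<kappa> \<and> \<kappa> < 1 \<and>
           (\<forall>n::nat.
              hilbert_dist \<mu> (coneG x0 \<mu> m1 m2 \<alpha>1 \<alpha>1') g1s (fst (sinkhorn \<mu> \<nu> c \<epsilon> n))
              + hilbert_dist \<nu> (coneG x0 \<nu> m1' m2' \<alpha>2 \<alpha>2') g2s (snd (sinkhorn \<mu> \<nu> c \<epsilon> n))
                \<le> ereal (A * \<kappa> ^ n)
            \<and> tv_dist (\<mu> \<Otimes>\<^sub>M \<nu>)
                 (coupling_density c \<epsilon> (fst (sinkhorn \<mu> \<nu> c \<epsilon> n)) (snd (sinkhorn \<mu> \<nu> c \<epsilon> n)))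
                 (coupling_density c \<epsilon> g1s g2s)
                \<le> ennreal (A * \<kappa> ^ n))"
proof -
  note c_meas = assms(6) and lims = assms(11,12)
  interpret M: prob_space \<mu> by fact
  interpret N: prob_space \<nu> by fact
  note sets = assms(2,4)
  note pos = \<open>0 < \<epsilon>\<close> \<open>0 < p\<close> \<open>0 < \<delta>\<close>
  have [measurable_cong]: "sets \<mu> = sets borel" "sets \<nu> = sets borel" by (fact sets)+
  obtain K where K: "0 \<le> K" "\<And>x y. c (x, y) \<le> K + dist x0 x powr p + dist x0 y powr p"
    using locally_bounded_cost[OF pos(2) lims(1)] by blast
  obtain m :: nat where m: "0 < m" "\<And>r. real m \<le> r \<Longrightarrow> measure \<mu> (- cball x0 r) \<le> exp (- (r powr (p + \<delta>)))"
    "\<And>r. real m \<le> r \<Longrightarrow> measure \<nu> (- cball x0 r) \<le> exp (- (r powr (p + \<delta>)))"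
    using exponential_tail[OF lims(2)] by blast
  define \<sigma> where "\<sigma> r = (K + r powr p) / \<epsilon>" for r
  define S where "S x = \<sigma> (dist x0 x)" for x
  have \<sigma>_mono: "\<sigma> r \<le> \<sigma> r'" if "0 \<le> r" "r \<le> r'" for r r'
    using that pos unfolding \<sigma>_def by (intro divide_right_mono add_left_mono powr_mono2) auto
  have \<sigma>0: "0 \<le> \<sigma> r" for r using K pos by (simp add: \<sigma>_def)
  have \<sigma>_meas [measurable]: "\<sigma> \<in> borel_measurable borel" unfolding \<sigma>_def[abs_def] by measurable
  have S0: "0 \<le> S x" for x by (simp add: S_def \<sigma>0)
  have S_meas: "S \<in> borel_measurable \<mu>" "S \<in> borel_measurable \<nu>"
    unfolding S_def[abs_def] by (rule borel_measurable_dist_centre[OF _ \<sigma>_meas]; fact)+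
  have sm: "summable (\<lambda>j. exp (4 * \<sigma> (real j + 1)) * exp (- (real j powr (p + \<delta>))))"
    unfolding \<sigma>_def by (rule summable_exp_powr_diff) fact+
  have S4': "integrable \<rho> (\<lambda>x. exp (4 * S x))"
    if "prob_space \<rho>" "sets \<rho> = sets borel" "\<And>r. real m \<le> r \<Longrightarrow> measure \<rho> (- cball x0 r) \<le> exp (- (r powr (p + \<delta>)))" for \<rho>
    unfolding S_def
  proof (rule integrable_radial[where \<phi> = "\<lambda>r. exp (4 * \<sigma> r)", OF that(1,2) _ _ _ that(3) sm])
    show "exp (4 * \<sigma> r) \<le> exp (4 * \<sigma> r')" if "0 \<le> r" "r \<le> r'" for r r'
      using \<sigma>_mono[OF that] by simp
  qed simp_all
  have S4: "integrable \<mu> (\<lambda>x. exp (4 * S x))" "integrable \<nu> (\<lambda>x. exp (4 * S x))"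
    using S4'[OF assms(1,2) m(2)] S4'[OF assms(3,4) m(3)] by auto
  define k where "k x y = exp (- c (x, y) / \<epsilon>)" for x y
  interpret B: bounded_kernel \<mu> \<nu> k S S
  proof unfold_locales
    show "space \<mu> = UNIV" "space \<nu> = UNIV" using sets_eq_imp_space_eq[OF sets(1)] sets_eq_imp_space_eq[OF sets(2)] by auto
    have "case_prod k = (\<lambda>z. exp (- c z / \<epsilon>))" by (auto simp: k_def)
    then show "case_prod k \<in> borel_measurable (\<mu> \<Otimes>\<^sub>M \<nu>)" using c_meas by simp
    fix x y
    show "k x y \<le> 1" using assms(7)[of "(x, y)"] pos by (simp add: k_def)
    \<comment> \<open>Both weights contain \<open>K\<close>; counting it twice only enlarges the
      bound because \<open>K >= 0\<close>.\<close>
    have "c (x, y) \<le> K + dist x0 x powr p + (K + dist x0 y powr p)" using K(2)[of x y] K(1) by linarith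
    then have "c (x, y) / \<epsilon> \<le> S x + S y"
      using pos unfolding S_def \<sigma>_def add_divide_distrib[symmetric] by (intro divide_right_mono) auto
    then show "exp (- S x - S y) \<le> k x y" by (simp add: k_def)
  qed (use S_meas S0 S4 in auto)
  interpret D: bounded_kernel \<nu> \<mu> "\<lambda>y x. k x y" S S by (rule B.dual)
  have Tnu: "T_nu \<nu> c \<epsilon> g = sch \<nu> k g" if "g \<in> borel_measurable \<nu>" "\<And>y. 0 \<le> g y" for g
    using T_nu_eq_sch[OF B.k_section[unfolded k_def] that] by (auto simp: k_def[abs_def])
  have Tmu: "T_mu \<mu> c \<epsilon> g = sch \<mu> (\<lambda>y x. k x y) g" if "g \<in> borel_measurable \<mu>" "\<And>y. 0 \<le> g y" for g
    using T_mu_eq_sch[OF D.k_section[unfolded k_def] that] by (auto simp: k_def[abs_def])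
  define a where "a n = fst (sinkhorn \<mu> \<nu> c \<epsilon> n)" for n
  define b where "b n = snd (sinkhorn \<mu> \<nu> c \<epsilon> n)" for n
  have a0: "a 0 = (\<lambda>_. 1)" and b0: "b 0 = (\<lambda>_. 1)" by (simp_all add: a_def b_def)
  have aT: "a (Suc n) = T_nu \<nu> c \<epsilon> (b n)" and bT: "b (Suc n) = T_mu \<mu> c \<epsilon> (a (Suc n))" for n
    by (simp_all add: a_def b_def Let_def)
  \<comment> \<open>The operators agree with \<open>sch\<close> on nonnegative measurable functions,
    so these two properties must come before any quantitative bound.\<close>
  have mb: "b n \<in> borel_measurable \<nu> \<and> (\<forall>y. 0 \<le> b n y)" for n
  proof (induction n)
    case 0 then show ?case by (simp add: b0)
  next
    case (Suc n)
    then have "a (Suc n) = sch \<nu> k (b n)" using Tnu aT by simp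
    then have "a (Suc n) \<in> borel_measurable \<mu>" "\<And>x. 0 \<le> a (Suc n) x"
      using B.sch_nonneg_measurable Suc by auto
    then show ?case using D.sch_nonneg_measurable Tmu bT by auto
  qed
  have aS: "a (Suc n) = sch \<nu> k (b n)" for n using Tnu aT mb by simp
  have bS: "b (Suc n) = sch \<mu> (\<lambda>y x. k x y) (a (Suc n))" for n
    using Tmu bT B.sch_nonneg_measurable mb by (simp add: aS)
  \<comment> \<open>The given potentials solve their equations almost everywhere. \<open>G1\<close>
    and \<open>G2\<close> are versions for which both equations and the bounds hold at every
    point.\<close>
  define G1 where "G1 = sch \<nu> k g2s"
  define G2 where "G2 = sch \<mu> (\<lambda>y x. k x y) g1s"
  note gm = assms(13,14) and gp = assms(15,16)
  have gT: "AE x in \<mu>. g1s x = sch \<nu> k g2s x" "AE y in \<nu>. g2s y = sch \<mu> (\<lambda>y x. k x y) g1s y"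
    using assms(17,18) Tnu[OF gm(2)] Tmu[OF gm(1)] gp by (auto simp: less_imp_le)
  note i1 = B.schroedinger_integrable[OF gm(2) gp(2) gm(1) gp(1) gT(1)]
  note i2 = D.schroedinger_integrable[OF gm(1) gp(1) gm(2) gp(2) gT(2)]
  obtain l1 u1 where G1a: "adm \<mu> S l1 u1 G1"
    using B.schroedinger_adm[OF gm(2) gp(2) i2(3) i1(1,2)] unfolding G1_def by blast
  obtain l2 u2 where G2a: "adm \<nu> S l2 u2 G2"
    using D.schroedinger_adm[OF gm(1) gp(1) i1(3) i2(1,2)] unfolding G2_def by blast
  have gG: "AE x in \<mu>. g1s x = G1 x" "AE y in \<nu>. g2s y = G2 y" using gT by (simp_all add: G1_def G2_def)
  have GG1: "G1 = sch \<nu> k G2"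
    unfolding G1_def by (rule B.sch_cong_AE) (use gm gG B.adm_measurable[OF G2a] in auto)
  have GG2: "G2 = sch \<mu> (\<lambda>y x. k x y) G1"
    unfolding G2_def by (rule D.sch_cong_AE) (use gm gG D.adm_measurable[OF G1a] in auto)
  obtain l u C Q \<kappa> where \<kappa>: "0 < \<kappa>" "\<kappa> < 1" and C: "0 < C"
    and adm: "\<And>n. adm \<mu> S l u (a n)" "\<And>n. adm \<nu> S l u (b n)" "adm \<mu> S l u G1" "adm \<nu> S l u G2"
    and conv: "\<And>n. \<exists>q. \<bar>q\<bar> \<le> Q \<and> (\<forall>x. \<bar>a n x - exp q * G1 x\<bar> \<le> C * \<kappa> ^ n * exp (2 * S x))"
    "\<And>n. \<exists>q. \<bar>q\<bar> \<le> Q \<and> (\<forall>y. \<bar>b n y - exp q * G2 y\<bar> \<le> C * \<kappa> ^ n * exp (2 * S y))"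
    using B.sinkhorn_convergence[OF a0 b0 aS bS G1a G2a GG1 GG2] by metis
  have l: "0 < l" and u: "0 < u" using adm(3) adm_bound_pos[OF adm(3)] by (auto simp: adm_def)

  define \<phi> where "\<phi> r = exp (2 * \<sigma> r)" for r
  \<comment> \<open>Positive as the cone requires, yet so small that the weighted tail series has
    terms \<open>exp (- 1) ^ j\<close>; its sum gives the constant \<open>L\<close>.\<close>
  define \<alpha> where "\<alpha> r = exp (- r) / \<phi> (r + 1)" for r
  have \<phi>_mono: "\<phi> r \<le> \<phi> r'" if "0 \<le> r" "r \<le> r'" for r r' using \<sigma>_mono[OF that] by (simp add: \<phi>_def)
  have \<phi>0: "1 \<le> \<phi> 0" "0 \<le> \<phi> 0" using \<sigma>0[of 0] by (simp_all add: \<phi>_def)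
  have \<phi>_meas: "\<phi> \<in> borel_measurable borel" unfolding \<phi>_def[abs_def] by measurable
  have \<alpha>pos: "0 < \<alpha> r" for r by (simp add: \<alpha>_def \<phi>_def)
  then have \<alpha>0: "0 \<le> \<alpha> r" for r by (simp add: less_imp_le)
  have tail: "tail_function \<alpha>"
    using tail_function_exp_divide[of \<phi>, OF \<phi>_mono \<phi>0(1)] by (simp add: \<alpha>_def[abs_def])
  have tail0: "tail_function (\<lambda>_. 0)" by (simp add: tail_function_def)
  have \<phi>\<alpha>: "\<phi> (real j + 1) * \<alpha> (real j) = exp (- 1) ^ j" for j
    by (simp add: \<alpha>_def \<phi>_def exp_of_nat_mult[symmetric])
  have sm\<alpha>: "summable (\<lambda>j. \<phi> (real j + 1) * \<alpha> (real j))"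
    unfolding \<phi>\<alpha> by (rule summable_geometric) simp
  define L where "L = \<phi> m + (\<Sum>j. \<phi> (real (m + j) + 1) * \<alpha> (real (m + j)))"
  have L0: "0 \<le> L"
  proof -
    have "summable (\<lambda>j. \<phi> (real (m + j) + 1) * \<alpha> (real (m + j)))"
      using summable_ignore_initial_segment[OF sm\<alpha>, of m] by (simp add: add.commute)
    then show ?thesis unfolding L_def
      by (intro add_nonneg_nonneg suminf_nonneg mult_nonneg_nonneg \<alpha>0) (auto simp: \<phi>_def)
  qed
  have cone: "(\<integral>x. f x * exp (2 * S x) \<partial>\<rho>) \<le> L * (\<integral>x. f x \<partial>\<rho>)"
    if "prob_space \<rho>" "sets \<rho> = sets borel" "f \<in> coneF x0 \<rho> m m \<alpha> (\<lambda>_. 0)" for f \<rho>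
    using coneF_weighted[OF that(1,2) \<phi>_mono \<phi>0(2) \<phi>_meas \<alpha>0 sm\<alpha> m(1) that(3)]
    by (simp add: L_def S_def \<phi>_def)
  have m1: "exp (- (real m powr (p + \<delta>))) < 1" using m(1) by simp
  have ballM: "0 < measure \<mu> (cball x0 m)"
    by (rule measure_cball_pos[OF assms(1,2) le_less_trans[OF m(2)[OF order.refl] m1]])
  have ballN: "0 < measure \<nu> (cball x0 m)"
    by (rule measure_cball_pos[OF assms(3,4) le_less_trans[OF m(3)[OF order.refl] m1]])

  \<comment> \<open>Hilbert's metric along the iteration\<close>
  define H where "H = 2 * (L * exp Q / l) * C"
  have H0: "0 \<le> H" using L0 l C by (simp add: H_def)
  have d0: "0 \<le> C * \<kappa> ^ n" for n using C \<kappa> by simp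
  have HM: "hilbert_dist \<mu> (coneG x0 \<mu> m m \<alpha> (\<lambda>_. 0)) g1s (a n) \<le> ereal (H * \<kappa> ^ n)" for n
  proof -
    obtain q where q: "\<bar>q\<bar> \<le> Q" "\<And>x. \<bar>a n x - exp q * G1 x\<bar> \<le> C * \<kappa> ^ n * exp (2 * S x)" using conv(1) by blast
    have "hilbert_dist \<mu> (coneG x0 \<mu> m m \<alpha> (\<lambda>_. 0)) g1s (a n) \<le> ereal (2 * (L * exp Q / l) * (C * \<kappa> ^ n))"
    proof (rule hilbert_dist_le[OF assms(1,2) S_meas(1) S0 S4(1) cone[OF assms(1,2)] L0 \<alpha>0 _ ballM gm(1) _ l _ _ q(1) d0])
      show "AE x in \<mu>. l \<le> g1s x \<and> g1s x \<le> u * exp (S x)"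
        using gG(1) by eventually_elim (use adm(3) in \<open>simp add: adm_def\<close>)
      show "AE x in \<mu>. \<bar>a n x - exp q * g1s x\<bar> \<le> C * \<kappa> ^ n * exp (2 * S x)"
        using gG(1) by eventually_elim (use q(2) in simp)
      show "AE x in \<mu>. l \<le> a n x \<and> a n x \<le> u * exp (S x)" using adm(1)[of n] by (simp add: adm_def)
    qed (use adm(1)[of n] m(1) in \<open>auto simp: adm_def\<close>)
    then show ?thesis by (simp add: H_def mult.assoc)
  qed
  have HN: "hilbert_dist \<nu> (coneG x0 \<nu> m m \<alpha> (\<lambda>_. 0)) g2s (b n) \<le> ereal (H * \<kappa> ^ n)" for n
  proof -
    obtain q where q: "\<bar>q\<bar> \<le> Q" "\<And>x. \<bar>b n x - exp q * G2 x\<bar> \<le> C * \<kappa> ^ n * exp (2 * S x)" using conv(2) by blast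
    have "hilbert_dist \<nu> (coneG x0 \<nu> m m \<alpha> (\<lambda>_. 0)) g2s (b n) \<le> ereal (2 * (L * exp Q / l) * (C * \<kappa> ^ n))"
    proof (rule hilbert_dist_le[OF assms(3,4) S_meas(2) S0 S4(2) cone[OF assms(3,4)] L0 \<alpha>0 _ ballN gm(2) _ l _ _ q(1) d0])
      show "AE x in \<nu>. l \<le> g2s x \<and> g2s x \<le> u * exp (S x)"
        using gG(2) by eventually_elim (use adm(4) in \<open>simp add: adm_def\<close>)
      show "AE x in \<nu>. \<bar>b n x - exp q * g2s x\<bar> \<le> C * \<kappa> ^ n * exp (2 * S x)"
        using gG(2) by eventually_elim (use q(2) in simp)
      show "AE x in \<nu>. l \<le> b n x \<and> b n x \<le> u * exp (S x)" using adm(2)[of n] by (simp add: adm_def)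
    qed (use adm(2)[of n] m(1) in \<open>auto simp: adm_def\<close>)
    then show ?thesis by (simp add: H_def mult.assoc)
  qed

  \<comment> \<open>Total variation along the iteration\<close>
  interpret P: pair_sigma_finite \<mu> \<nu> ..
  define E where "E = 2 * (C * u * (1 + exp Q) * (\<integral>x. exp (2 * S x) \<partial>\<mu>) * (\<integral>y. exp (2 * S y) \<partial>\<nu>))"
  let ?f = "\<lambda>n (x, y). k x y * a n x * b n y" and ?g = "\<lambda>(x, y). k x y * G1 x * G2 y"
  have fi: "integrable (\<mu> \<Otimes>\<^sub>M \<nu>) (?f n)" "0 \<le> ?f n z" for n z
    using B.pair_integrable[OF adm(2) adm(1)] B.pair_integrand_nonneg[OF adm(2) adm(1)] by auto
  have gi: "integrable (\<mu> \<Otimes>\<^sub>M \<nu>) ?g" "0 \<le> ?g z" for z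
    using B.pair_integrable[OF adm(4,3)] B.pair_integrand_nonneg[OF adm(4,3)] by auto
  have gmass: "(\<integral>z. ?g z \<partial>(\<mu> \<Otimes>\<^sub>M \<nu>)) = 1" using B.pair_mass[OF adm(4)] GG1 by simp
  have L1: "(\<integral>z. \<bar>?f n z - ?g z\<bar> \<partial>(\<mu> \<Otimes>\<^sub>M \<nu>)) \<le> max 2 E * \<kappa> ^ n" for n
  proof (cases n)
    \<comment> \<open>The initial pair of constants is not normalized, so the mass argument fails
      here; the trivial bound 2 is the reason for \<open>max 2 E\<close>.\<close>
    case 0
    have "(\<integral>z. ?f 0 z \<partial>(\<mu> \<Otimes>\<^sub>M \<nu>)) \<le> 1" using B.pair_mass_const_le by (simp add: a0 b0)
    then have "(\<integral>z. \<bar>?f 0 z - ?g z\<bar> \<partial>(\<mu> \<Otimes>\<^sub>M \<nu>)) \<le> 2"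
      by (intro integral_abs_diff_le_two fi gi) (use gmass in simp_all)
    then show ?thesis using 0 by (simp del: split_paired_All)
  next
    case (Suc j)
    have fmass: "(\<integral>z. ?f n z \<partial>(\<mu> \<Otimes>\<^sub>M \<nu>)) = 1" using B.pair_mass_dual[OF adm(1)[of n]] bS Suc by simp
    obtain q where q: "\<bar>q\<bar> \<le> Q" "\<And>x. \<bar>a n x - exp q * G1 x\<bar> \<le> C * \<kappa> ^ n * exp (2 * S x)" using conv(1) by blast
    obtain q' where q': "\<bar>q'\<bar> \<le> Q" "\<And>x. \<bar>b n x - exp q' * G2 x\<bar> \<le> C * \<kappa> ^ n * exp (2 * S x)" using conv(2) by blast
    have "(\<integral>z. \<bar>?f n z - ?g z\<bar> \<partial>(\<mu> \<Otimes>\<^sub>M \<nu>)) \<le> E * \<kappa> ^ n"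
      using B.pair_L1_bound[OF adm(1,2,3,4) q q' d0 fmass gmass]
      by (simp add: E_def case_prod_beta' mult_ac)
    also have "\<dots> \<le> max 2 E * \<kappa> ^ n" using \<kappa> by (intro mult_right_mono) auto
    finally show ?thesis .
  qed
  have AEz: "AE z in \<mu> \<Otimes>\<^sub>M \<nu>. g1s (fst z) = G1 (fst z) \<and> g2s (snd z) = G2 (snd z)"
  proof (rule P.AE_pair_measure)
    have [measurable]: "G1 \<in> borel_measurable \<mu>" "G2 \<in> borel_measurable \<nu>" using adm(3,4) by (auto simp: adm_def)
    note [measurable] = gm
    show "{z \<in> space (\<mu> \<Otimes>\<^sub>M \<nu>). g1s (fst z) = G1 (fst z) \<and> g2s (snd z) = G2 (snd z)} \<in> sets (\<mu> \<Otimes>\<^sub>M \<nu>)"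
      by measurable
    show "AE x in \<mu>. AE y in \<nu>. g1s (fst (x, y)) = G1 (fst (x, y)) \<and> g2s (snd (x, y)) = G2 (snd (x, y))"
      using gG(1)
    proof eventually_elim
      case (elim x)
      from gG(2) show ?case by eventually_elim (simp add: elim)
    qed
  qed
  have TV: "tv_dist (\<mu> \<Otimes>\<^sub>M \<nu>) (coupling_density c \<epsilon> (a n) (b n)) (coupling_density c \<epsilon> g1s g2s)
      \<le> ennreal (max 2 E * \<kappa> ^ n)" for n
  proof -
    have "tv_dist (\<mu> \<Otimes>\<^sub>M \<nu>) (coupling_density c \<epsilon> (a n) (b n)) (coupling_density c \<epsilon> g1s g2s)
        = (\<integral>\<^sup>+z. ennreal \<bar>?f n z - ?g z\<bar> \<partial>(\<mu> \<Otimes>\<^sub>M \<nu>))"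
      unfolding tv_dist_def
      by (rule nn_integral_cong_AE, use AEz in eventually_elim)
         (simp add: coupling_density_def k_def case_prod_beta')
    also have "\<dots> = ennreal (\<integral>z. \<bar>?f n z - ?g z\<bar> \<partial>(\<mu> \<Otimes>\<^sub>M \<nu>))"
      by (rule nn_integral_eq_integral[OF integrable_abs[OF Bochner_Integration.integrable_diff[OF fi(1) gi(1)]]]) simp
    also have "\<dots> \<le> ennreal (max 2 E * \<kappa> ^ n)" by (rule ennreal_leI[OF L1])
    finally show ?thesis .
  qed

  \<comment> \<open>One \<open>H\<close> for each of the two Hilbert distances.\<close>
  define A where "A = 2 * H + max 2 E"
  have A: "0 < A" "max 2 E \<le> A" "2 * H \<le> A" using H0 by (auto simp: A_def)
  have final: "hilbert_dist \<mu> (coneG x0 \<mu> m m \<alpha> (\<lambda>_. 0)) g1s (fst (sinkhorn \<mu> \<nu> c \<epsilon> n))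
          + hilbert_dist \<nu> (coneG x0 \<nu> m m \<alpha> (\<lambda>_. 0)) g2s (snd (sinkhorn \<mu> \<nu> c \<epsilon> n)) \<le> ereal (A * \<kappa> ^ n)
      \<and> tv_dist (\<mu> \<Otimes>\<^sub>M \<nu>)
           (coupling_density c \<epsilon> (fst (sinkhorn \<mu> \<nu> c \<epsilon> n)) (snd (sinkhorn \<mu> \<nu> c \<epsilon> n)))
           (coupling_density c \<epsilon> g1s g2s) \<le> ennreal (A * \<kappa> ^ n)" for n
  proof
    have "hilbert_dist \<mu> (coneG x0 \<mu> m m \<alpha> (\<lambda>_. 0)) g1s (a n)
          + hilbert_dist \<nu> (coneG x0 \<nu> m m \<alpha> (\<lambda>_. 0)) g2s (b n) \<le> ereal (H * \<kappa> ^ n) + ereal (H * \<kappa> ^ n)"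
      by (rule add_mono[OF HM HN])
    also have "\<dots> \<le> ereal (A * \<kappa> ^ n)" using mult_right_mono[OF A(3), of "\<kappa> ^ n"] \<kappa> by simp
    finally show "hilbert_dist \<mu> (coneG x0 \<mu> m m \<alpha> (\<lambda>_. 0)) g1s (fst (sinkhorn \<mu> \<nu> c \<epsilon> n))
          + hilbert_dist \<nu> (coneG x0 \<nu> m m \<alpha> (\<lambda>_. 0)) g2s (snd (sinkhorn \<mu> \<nu> c \<epsilon> n)) \<le> ereal (A * \<kappa> ^ n)"
      by (simp add: a_def b_def)
    have "ennreal (max 2 E * \<kappa> ^ n) \<le> ennreal (A * \<kappa> ^ n)"
      using A(2) \<kappa> by (intro ennreal_leI mult_right_mono) auto
    with TV[of n] show "tv_dist (\<mu> \<Otimes>\<^sub>M \<nu>)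
           (coupling_density c \<epsilon> (fst (sinkhorn \<mu> \<nu> c \<epsilon> n)) (snd (sinkhorn \<mu> \<nu> c \<epsilon> n)))
           (coupling_density c \<epsilon> g1s g2s) \<le> ennreal (A * \<kappa> ^ n)"
      unfolding a_def b_def by (rule order_trans)
  qed
  have m0: "0 < real m" using m(1) by simp
  show ?thesis
    by (rule exI[of _ "real m"], rule exI[of _ "real m"], rule exI[of _ \<alpha>], rule exI[of _ "\<lambda>_. 0"],
        rule exI[of _ "real m"], rule exI[of _ "real m"], rule exI[of _ \<alpha>], rule exI[of _ "\<lambda>_. 0"],
        rule exI[of _ A], rule exI[of _ \<kappa>], intro conjI allI impI)
       (rule m0 order.refl tail tail0 \<alpha>pos ballM ballN A(1) \<kappa> final[THEN conjunct1] final[THEN conjunct2])+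
qed

end
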